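(* Let $S=K[x_1,\ldots,x_n]$ be a standard graded polynomial ring over a field $K$ and let $I\subset S$ be a nonzero proper graded principal ideal. Then $I$ has linear powers and $\mathrm{v}_{\mathfrak{p}}(I^k)=\alpha(I)k-\alpha(\mathfrak{p})$ for all $\mathfrak{p}\in\operatorname{Ass}(I^k)$ and for all $k\geq 1$. In particular, $\mathrm{v}(I^k)=\alpha(I)k-c(I)$ for all $k\geq 1$.
   Context: $S=\bigoplus_{d\ge 0}S_d$ is graded with $\deg x_i=1$. $\operatorname{Ass}(I)$ denotes the set of associated primes of $I$ (i.e. of $S/I$). For a nonzero graded ideal $I$, $\alpha(I):=\min\{\deg(f)\mid f\in I\setminus\{0\}\}$ (over homogeneous $f$). $c(I):=\max\{\alpha(\mathfrak{p})\mid \mathfrak{p}\in\operatorname{Ass}(I)\}$. An equigenerated graded ideal $I$ (generated by homogeneous elements of a single degree) has a linear resolution if its Castelnuovo–Mumford regularity satisfies $\operatorname{reg}(I)=\alpha(I)$; $I$ has linear powers if $I^k$ has a linear resolution for all $k\ge 1$. For a proper graded ideal $I$ and $\mathfrak{p}\in\operatorname{Ass}(I)$, $\mathrm{v}_{\mathfrak{p}}(I):=\min\{d\geq 0\mid \exists f\in S_d \text{ with } (I:f)=\mathfrak{p}\}$, and $\mathrm{v}(I):=\min\{d\geq 0\mid \exists f\in S_d,\ \mathfrak{p}\in\operatorname{Ass}(I)\text{ with }(I:f)=\mathfrak{p}\}$. Here $(I:f)=\{g\in S\mid gf\in I\}$. *)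

theory Defs
  imports
    "HOL-Library.Poly_Mapping"
    "HOL-Algebra.Ideal_Product"
    "Jordan_Normal_Form.Matrix_Kernel"
begin

text \<open>
  The polynomial ring \<open>S = K[x\<^sub>1,\<dots>,x\<^sub>n]\<close>: the type \<open>'n\<close> indexes the variables, so
  \<open>n = CARD('n)\<close>. Exponent vectors are finitely supported maps \<open>'n \<Rightarrow>\<^sub>0 nat\<close>, and the
  multiplication of \<^theory>\<open>HOL-Library.Poly_Mapping\<close> is the convolution product.
  Ideals are those of HOL-Algebra for the ring record \<open>class_ring\<close> on the whole type.
\<close>

type_synonym ('n, 'k) mpoly = "('n \<Rightarrow>\<^sub>0 nat) \<Rightarrow>\<^sub>0 'k"

definition monom_deg :: "('n::finite \<Rightarrow>\<^sub>0 nat) \<Rightarrow> nat" where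
  "monom_deg m = (\<Sum>i\<in>UNIV. Poly_Mapping.lookup m i)"

text \<open>
  The degrees range over all integers, so that shifted modules can be handled uniformly;
  the component is \<open>{0}\<close> in negative degrees. Every component contains 0.
\<close>

definition graded_part :: "int \<Rightarrow> ('n::finite, 'k::field) mpoly set" where
  "graded_part d = {f. \<forall>m\<in>Poly_Mapping.keys f. int (monom_deg m) = d}"

definition graded_ideal :: "('n::finite, 'k::field) mpoly set \<Rightarrow> bool" where
  "graded_ideal I \<longleftrightarrow>
     ideal I class_ring \<and> I = genideal class_ring (I \<inter> (\<Union>d. graded_part d))"

definition equigenerated :: "('n::finite, 'k::field) mpoly set \<Rightarrow> bool" where
  "equigenerated I \<longleftrightarrow>
     ideal I class_ring \<and> (\<exists>d. I = genideal class_ring (I \<inter> graded_part d))"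

abbreviation ideal_power :: "('n::finite, 'k::field) mpoly set \<Rightarrow> nat \<Rightarrow> ('n, 'k) mpoly set" where
  "ideal_power I k \<equiv> I [^]\<^bsub>ideals_set class_ring\<^esub> k"

definition irrelevant_ideal :: "('n::finite, 'k::field) mpoly set" where
  "irrelevant_ideal = genideal class_ring {Poly_Mapping.single (Poly_Mapping.single i 1) 1 | i. True}"

definition initial_degree :: "('n::finite, 'k::field) mpoly set \<Rightarrow> nat" where
  "initial_degree I = (LEAST d. \<exists>f\<in>I - {0}. f \<in> graded_part (int d))"

definition colon :: "('n::finite, 'k::field) mpoly set \<Rightarrow> ('n, 'k) mpoly \<Rightarrow> ('n, 'k) mpoly set" where
  "colon I f = {g. g * f \<in> I}"

definition Ass :: "('n::finite, 'k::field) mpoly set \<Rightarrow> ('n, 'k) mpoly set set" where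
  "Ass I = {P. primeideal P class_ring \<and> (\<exists>f. P = colon I f)}"

definition max_initial_degree :: "('n::finite, 'k::field) mpoly set \<Rightarrow> nat" where
  "max_initial_degree I = Max (initial_degree ` Ass I)"

definition local_v_number :: "('n::finite, 'k::field) mpoly set \<Rightarrow> ('n, 'k) mpoly set \<Rightarrow> nat" where
  "local_v_number P I = (LEAST d. \<exists>f\<in>graded_part (int d). colon I f = P)"

definition v_number :: "('n::finite, 'k::field) mpoly set \<Rightarrow> nat" where
  "v_number I = (LEAST d. \<exists>f\<in>graded_part (int d). \<exists>P\<in>Ass I. colon I f = P)"

text \<open>
  A minimal graded free resolution \<open>\<dots> \<rightarrow> F\<^sub>1 \<rightarrow> F\<^sub>0 \<rightarrow> I \<rightarrow> 0\<close> of the ideal \<open>I\<close> (not of \<open>S/I\<close>).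
  The module \<open>F\<^sub>i\<close> is the direct sum of the \<open>S(-a i ! p)\<close> with \<open>p < length (a i)\<close>, so its
  \<open>p\<close>-th basis element has degree \<open>a i ! p\<close>. The \<open>1 \<times> length (a 0)\<close> matrix \<open>\<phi> 0\<close> represents
  the augmentation \<open>F\<^sub>0 \<rightarrow> I\<close>, and \<open>\<phi> (Suc i)\<close> represents \<open>F\<^bsub>i+1\<^esub> \<rightarrow> F\<^sub>i\<close>. The conditions on
  the entries say that these maps preserve degrees and that \<open>F\<^bsub>i+1\<^esub>\<close> is mapped into
  \<open>\<mm> F\<^sub>i\<close>, where \<open>\<mm> = (x\<^sub>1,\<dots>,x\<^sub>n)\<close>.
\<close>

definition minimal_graded_free_resolution ::
  "('n::finite, 'k::field) mpoly set \<Rightarrow> (nat \<Rightarrow> int list) \<Rightarrow> (nat \<Rightarrow> ('n, 'k) mpoly mat) \<Rightarrow> bool"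
  where
  "minimal_graded_free_resolution I a \<phi> \<longleftrightarrow>
     \<phi> 0 \<in> carrier_mat 1 (length (a 0)) \<and>
     (\<forall>i. \<phi> (Suc i) \<in> carrier_mat (length (a i)) (length (a (Suc i)))) \<and>
     (\<forall>p < length (a 0). \<phi> 0 $$ (0, p) \<in> graded_part (a 0 ! p)) \<and>
     (\<forall>i. \<forall>q < length (a i). \<forall>p < length (a (Suc i)).
        \<phi> (Suc i) $$ (q, p) \<in> graded_part (a (Suc i) ! p - a i ! q) \<inter> irrelevant_ideal) \<and>
     (\<lambda>w. (\<phi> 0 *\<^sub>v w) $ 0) ` carrier_vec (length (a 0)) = I \<and>
     (\<forall>i. mat_kernel (\<phi> i) = (\<lambda>w. \<phi> (Suc i) *\<^sub>v w) ` carrier_vec (length (a (Suc i))))"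

text \<open>
  The graded Betti numbers do not depend on the chosen minimal graded free resolution,
  which justifies the definite description.
\<close>

definition graded_betti :: "('n::finite, 'k::field) mpoly set \<Rightarrow> nat \<Rightarrow> int \<Rightarrow> nat" where
  "graded_betti I i j =
     (THE b. \<exists>a \<phi>. minimal_graded_free_resolution I a \<phi> \<and> b = count_list (a i) j)"

definition regularity :: "('n::finite, 'k::field) mpoly set \<Rightarrow> int" where
  "regularity I = Max {j - int i | i j. graded_betti I i j \<noteq> 0}"

definition linear_resolution :: "('n::finite, 'k::field) mpoly set \<Rightarrow> bool" where
  "linear_resolution I \<longleftrightarrow> equigenerated I \<and> regularity I = int (initial_degree I)"

definition linear_powers :: "('n::finite, 'k::field) mpoly set \<Rightarrow> bool" where
  "linear_powers I \<longleftrightarrow> (\<forall>k\<ge>1. linear_resolution (ideal_power I k))"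

end

theory Submission
  imports Defs
begin

text \<open>
  The polynomial ring \<open>S\<close> is a domain, and factors of nonzero homogeneous polynomials are
  homogeneous (\<open>homogeneous_factor\<close>). So \<open>I = (g)\<close> with \<open>g\<close> homogeneous of degree \<open>\<alpha>(I)\<close>, and
  \<open>I\<^sup>k = (h)\<close> with \<open>h = g\<^sup>k\<close> homogeneous of degree \<open>\<alpha>(I) k\<close>. Everything reduces to a principal
  ideal with a homogeneous generator \<open>h\<close>.

  Linear powers. Multiplication with \<open>h\<close> identifies \<open>(h)\<close> with \<open>S(-deg h)\<close>, a free module on one
  generator. A minimal graded resolution of it therefore has exactly one generator, in homological
  degree \<open>0\<close> and of degree \<open>deg h\<close> (\<open>generators_of_principal_ideal\<close>,
  \<open>no_higher_syzygies\<close>), and the regularity is \<open>deg h\<close>.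

  The v-numbers. Since \<open>S\<close> is factorial (\<open>polys_in_factorial\<close>), the associated primes of \<open>(h)\<close> are the
  ideals \<open>(p)\<close> of the prime factors \<open>p\<close> of \<open>h\<close> (\<open>Ass_multiples\<close>). The polynomials \<open>f\<close> with
  \<open>((h) : f) = (p)\<close> include \<open>h / p\<close> and are all multiples of it, so the least degree of a homogeneous one is
  \<open>deg h - deg p\<close>, where \<open>deg p = \<alpha>((p))\<close>. As \<open>g\<close> and \<open>g\<^sup>k\<close> have the same prime factors, the minimum over
  the finitely many associated primes is \<open>\<alpha>(I) k - c(I)\<close>.

  Factoriality is proved by induction on the set of variables, along the lines of Gauss's theorem that
  \<open>R[x]\<close> is factorial if \<open>R\<close> is. Fraction fields are avoided by pseudo-division; the
  denominators are cancelled by means of the prime factorizations in \<open>R\<close>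
  (\<open>prime_in_insert\<close>, \<open>prime_product_distribute\<close>).
\<close>

section \<open>Homogeneous components and zero divisors\<close>

text \<open>
  One notion of homogeneity serves two purposes: with the weight \<open>monom_deg\<close> it is the standard
  grading, and with the exponent of one variable \<open>x\<close> as weight it is the grading of a polynomial
  ring over the ring of coefficients that do not involve \<open>x\<close>.
\<close>
definition additive_weight :: "(('n \<Rightarrow>\<^sub>0 nat) \<Rightarrow> nat) \<Rightarrow> bool" where
  "additive_weight w \<longleftrightarrow> (\<forall>m m'. w (m + m') = w m + w m')"

definition homogeneous :: "(('n \<Rightarrow>\<^sub>0 nat) \<Rightarrow> nat) \<Rightarrow> nat \<Rightarrow> ('n, 'k::zero) mpoly \<Rightarrow> bool" where
  "homogeneous w d f \<longleftrightarrow> (\<forall>m\<in>Poly_Mapping.keys f. w m = d)"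

definition component :: "(('n \<Rightarrow>\<^sub>0 nat) \<Rightarrow> nat) \<Rightarrow> nat \<Rightarrow> ('n, 'k::zero) mpoly \<Rightarrow> ('n, 'k) mpoly" where
  "component w d f = Poly_Mapping.mapp (\<lambda>m c. if w m = d then c else 0) f"

definition weighted_degree :: "(('n \<Rightarrow>\<^sub>0 nat) \<Rightarrow> nat) \<Rightarrow> ('n, 'k::zero) mpoly \<Rightarrow> nat" where
  "weighted_degree w f = Max (insert 0 (w ` Poly_Mapping.keys f))"

lemma additive_weightD: "additive_weight w \<Longrightarrow> w (m + m') = w m + w m'"
  by (simp add: additive_weight_def)

lemma additive_weight_0: "additive_weight w \<Longrightarrow> w 0 = 0"
  using additive_weightD[of w 0 0] by simp

lemma additive_weight_exponent: "additive_weight (\<lambda>m. Poly_Mapping.lookup m x)"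
  by (simp add: additive_weight_def lookup_add)

lemma additive_weight_monom_deg: "additive_weight monom_deg"
  by (simp add: additive_weight_def monom_deg_def lookup_add sum.distrib)

lemma graded_part_iff_homogeneous: "f \<in> graded_part (int d) \<longleftrightarrow> homogeneous monom_deg d f"
  by (simp add: graded_part_def homogeneous_def)

lemma lookup_component:
  "Poly_Mapping.lookup (component w d f) m = (if w m = d then Poly_Mapping.lookup f m else 0)"
  by (simp add: component_def lookup_mapp in_keys_iff when_def)

lemma keys_component:
  "Poly_Mapping.keys (component w d f) = {m \<in> Poly_Mapping.keys f. w m = d}"
  by (auto simp: in_keys_iff lookup_component split: if_splits)

lemma component_add:
  fixes f :: "('n, 'k::monoid_add) mpoly"
  shows "component w d (f + g) = component w d f + component w d g"
  by (rule poly_mapping_eqI) (simp add: lookup_component lookup_add)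

lemma component_eq_0: "(\<And>m. m \<in> Poly_Mapping.keys f \<Longrightarrow> w m \<noteq> d) \<Longrightarrow> component w d f = 0"
  by (rule poly_mapping_eqI) (auto simp: lookup_component in_keys_iff)

lemma component_eq_self: "homogeneous w d f \<Longrightarrow> component w d f = f"
  by (rule poly_mapping_eqI) (auto simp: lookup_component homogeneous_def in_keys_iff)

lemma homogeneous_component: "homogeneous w d (component w d f)"
  by (simp add: homogeneous_def keys_component)

lemma homogeneous_mult:
  fixes f g :: "('n, 'k::field) mpoly"
  assumes "additive_weight w" "homogeneous w a f" "homogeneous w b g"
  shows "homogeneous w (a + b) (f * g)"
  using assms keys_mult[of f g] by (fastforce simp: homogeneous_def additive_weight_def)

text \<open>
  The hypothesis holds in the two extreme cases, when \<open>a\<close> and \<open>b\<close> are upper bounds or lower bounds for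
  the degrees that occur in \<open>f\<close> and \<open>g\<close>. One statement thus serves highest and lowest components.
\<close>
lemma component_mult_extremal:
  fixes f g :: "('n, 'k::field) mpoly"
  assumes w: "additive_weight w"
    and ext: "\<And>m m'. m \<in> Poly_Mapping.keys f \<Longrightarrow> m' \<in> Poly_Mapping.keys g \<Longrightarrow>
               w m + w m' = a + b \<Longrightarrow> w m = a \<and> w m' = b"
  shows "component w (a + b) (f * g) = component w a f * component w b g"
proof -
  let ?f = "component w a f" and ?g = "component w b g"
  have kf: "Poly_Mapping.keys (f - ?f) \<subseteq> {m \<in> Poly_Mapping.keys f. w m \<noteq> a}"
    by (auto simp: in_keys_iff lookup_component lookup_minus split: if_splits)
  have kg: "Poly_Mapping.keys (g - ?g) \<subseteq> {m \<in> Poly_Mapping.keys g. w m \<noteq> b}"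
    by (auto simp: in_keys_iff lookup_component lookup_minus split: if_splits)
  have 1: "component w (a + b) ((f - ?f) * g) = 0"
  proof (rule component_eq_0)
    fix m assume "m \<in> Poly_Mapping.keys ((f - ?f) * g)"
    then obtain u v where "m = u + v" "u \<in> Poly_Mapping.keys (f - ?f)" "v \<in> Poly_Mapping.keys g"
      using keys_mult[of "f - ?f" g] by blast
    thus "w m \<noteq> a + b"
      using kf ext[of u v] by (auto simp: additive_weightD[OF w])
  qed
  have 2: "component w (a + b) (?f * (g - ?g)) = 0"
  proof (rule component_eq_0)
    fix m assume "m \<in> Poly_Mapping.keys (?f * (g - ?g))"
    then obtain u v where "m = u + v" "u \<in> Poly_Mapping.keys ?f" "v \<in> Poly_Mapping.keys (g - ?g)"
      using keys_mult[of ?f "g - ?g"] by blast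
    thus "w m \<noteq> a + b"
      using kg ext[of u v] by (auto simp: additive_weightD[OF w] keys_component)
  qed
  have 3: "component w (a + b) (?f * ?g) = ?f * ?g"
    by (intro component_eq_self homogeneous_mult homogeneous_component w)
  \<comment> \<open>Split both factors into the selected component and the rest; only the first summand
    reaches the degree \<open>a + b\<close>.\<close>
  have "f * g = ?f * ?g + ((f - ?f) * g + ?f * (g - ?g))"
    by (simp add: algebra_simps)
  hence "component w (a + b) (f * g) = component w (a + b) (?f * ?g)
      + (component w (a + b) ((f - ?f) * g) + component w (a + b) (?f * (g - ?g)))"
    by (metis component_add)
  thus ?thesis using 1 2 3 by simp
qed

lemma weighted_degree_ge: "m \<in> Poly_Mapping.keys f \<Longrightarrow> w m \<le> weighted_degree w f"
  by (simp add: weighted_degree_def)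

lemma weighted_degree_attained:
  assumes "f \<noteq> 0"
  obtains m where "m \<in> Poly_Mapping.keys f" "w m = weighted_degree w f"
proof -
  have ne: "w ` Poly_Mapping.keys f \<noteq> {}" using assms by simp
  hence "weighted_degree w f = Max (w ` Poly_Mapping.keys f)"
    by (simp add: weighted_degree_def)
  also have "\<dots> \<in> w ` Poly_Mapping.keys f" using ne by (intro Max_in) auto
  finally show ?thesis using that by auto
qed

lemma weighted_degree_homogeneous: "homogeneous w d f \<Longrightarrow> f \<noteq> 0 \<Longrightarrow> weighted_degree w f = d"
  by (metis weighted_degree_attained homogeneous_def)

lemma weighted_degree_leI: "(\<And>m. m \<in> Poly_Mapping.keys f \<Longrightarrow> w m \<le> d) \<Longrightarrow> weighted_degree w f \<le> d"
  by (auto simp: weighted_degree_def)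

text \<open>
  For the exponent of \<open>x\<close> as weight this is the leading coefficient times the leading power of \<open>x\<close>.
\<close>
definition leading_form :: "(('n \<Rightarrow>\<^sub>0 nat) \<Rightarrow> nat) \<Rightarrow> ('n, 'k::zero) mpoly \<Rightarrow> ('n, 'k) mpoly" where
  "leading_form w f = component w (weighted_degree w f) f"

lemma leading_form_nonzero: "f \<noteq> 0 \<Longrightarrow> leading_form w f \<noteq> 0"
  by (rule weighted_degree_attained[of f w])
    (auto simp: leading_form_def keys_component simp flip: keys_eq_empty)

lemma component_mult_leading:
  fixes f g :: "('n, 'k::field) mpoly"
  assumes w: "additive_weight w"
  shows "component w (weighted_degree w f + weighted_degree w g) (f * g) = leading_form w f * leading_form w g"
  unfolding leading_form_def
proof (rule component_mult_extremal[OF w], goal_cases)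
  case (1 m m')
  thus ?case using weighted_degree_ge[of m f w] weighted_degree_ge[of m' g w] by linarith
qed

text \<open>
  Passing to leading forms with respect to one variable after the other reduces the claim to two
  polynomials that are homogeneous in every variable, that is, to two single terms. The set \<open>V\<close>
  contains the variables that have not been treated yet.
\<close>
lemma mult_nonzero_if_homogeneous_outside:
  fixes f g :: "('n::finite, 'k::field) mpoly"
  assumes "finite V" "f \<noteq> 0" "g \<noteq> 0"
    and "\<And>x. x \<notin> V \<Longrightarrow> \<exists>a. homogeneous (\<lambda>m. Poly_Mapping.lookup m x) a f"
    and "\<And>x. x \<notin> V \<Longrightarrow> \<exists>a. homogeneous (\<lambda>m. Poly_Mapping.lookup m x) a g"
  shows "f * g \<noteq> 0"
  using assms
proof (induction V arbitrary: f g rule: finite_induct)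
  case empty
  have mono: "\<exists>m c. c \<noteq> 0 \<and> h = Poly_Mapping.single m c"
    if "h \<noteq> 0" "\<And>x. \<exists>a. homogeneous (\<lambda>m. Poly_Mapping.lookup m x) a h" for h :: "('n, 'k) mpoly"
  proof -
    obtain m where m: "m \<in> Poly_Mapping.keys h" using \<open>h \<noteq> 0\<close> keys_eq_empty by blast
    have "m' = m" if "m' \<in> Poly_Mapping.keys h" for m'
      using that m \<open>\<And>x. \<exists>a. homogeneous (\<lambda>m. Poly_Mapping.lookup m x) a h\<close>
      by (intro poly_mapping_eqI) (metis homogeneous_def)
    hence "h = Poly_Mapping.single m (Poly_Mapping.lookup h m)"
      by (intro poly_mapping_eqI) (auto simp: lookup_single in_keys_iff when_def)
    thus ?thesis using m by (metis in_keys_iff)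
  qed
  obtain m c m' c' where "c \<noteq> 0" "c' \<noteq> 0" "f = Poly_Mapping.single m c" "g = Poly_Mapping.single m' c'"
    using mono[of f] mono[of g] empty by blast
  thus ?case by (simp add: mult_single flip: keys_eq_empty)
next
  case (insert x V)
  let ?w = "\<lambda>m. Poly_Mapping.lookup m x"
  have "leading_form ?w f * leading_form ?w g \<noteq> 0"
  proof (rule insert.IH)
    show "leading_form ?w f \<noteq> 0" "leading_form ?w g \<noteq> 0" using insert.prems by (simp_all add: leading_form_nonzero)
    fix y assume y: "y \<notin> V"
    show "\<exists>a. homogeneous (\<lambda>m. Poly_Mapping.lookup m y) a (leading_form ?w f)"
      using insert.prems(3)[of y] y
      by (cases "y = x") (auto simp: homogeneous_def leading_form_def keys_component)
    show "\<exists>a. homogeneous (\<lambda>m. Poly_Mapping.lookup m y) a (leading_form ?w g)"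
      using insert.prems(4)[of y] y
      by (cases "y = x") (auto simp: homogeneous_def leading_form_def keys_component)
  qed
  moreover have "component ?w d (0 :: ('n, 'k) mpoly) = 0" for d
    by (rule component_eq_0) simp
  ultimately show ?case
    using component_mult_leading[OF additive_weight_exponent, of x f g] by auto
qed

lemma mpoly_mult_eq_0_iff:
  fixes f g :: "('n::finite, 'k::field) mpoly"
  shows "f * g = 0 \<longleftrightarrow> f = 0 \<or> g = 0"
  using mult_nonzero_if_homogeneous_outside[of UNIV f g] by auto

lemma mpoly_mult_left_cancel:
  fixes a b c :: "('n::finite, 'k::field) mpoly"
  assumes "a \<noteq> 0"
  shows "a * b = a * c \<longleftrightarrow> b = c"
  using mpoly_mult_eq_0_iff[of a "b - c"] assms by (auto simp: algebra_simps)

lemma mpoly_power_nonzero: "g \<noteq> 0 \<Longrightarrow> (g :: ('n::finite, 'k::field) mpoly) ^ k \<noteq> 0"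
  by (induction k) (auto simp: mpoly_mult_eq_0_iff)

lemma weighted_degree_mult:
  fixes f g :: "('n::finite, 'k::field) mpoly"
  assumes w: "additive_weight w" and "f \<noteq> 0" "g \<noteq> 0"
  shows "weighted_degree w (f * g) = weighted_degree w f + weighted_degree w g"
proof (rule antisym)
  show "weighted_degree w (f * g) \<le> weighted_degree w f + weighted_degree w g"
  proof (rule weighted_degree_leI)
    fix m assume "m \<in> Poly_Mapping.keys (f * g)"
    then obtain u v where "m = u + v" "u \<in> Poly_Mapping.keys f" "v \<in> Poly_Mapping.keys g"
      using keys_mult[of f g] by blast
    thus "w m \<le> weighted_degree w f + weighted_degree w g"
      by (simp add: additive_weightD[OF w] add_mono weighted_degree_ge)
  qed
  have "leading_form w f * leading_form w g \<noteq> 0"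
    using assms by (simp add: mpoly_mult_eq_0_iff leading_form_nonzero)
  then obtain m where "m \<in> Poly_Mapping.keys (component w (weighted_degree w f + weighted_degree w g) (f * g))"
    by (metis component_mult_leading[OF w] keys_eq_empty all_not_in_conv)
  thus "weighted_degree w f + weighted_degree w g \<le> weighted_degree w (f * g)"
    using weighted_degree_ge[of m "f * g" w] by (simp add: keys_component)
qed

lemma leading_form_mult:
  fixes f g :: "('n::finite, 'k::field) mpoly"
  assumes w: "additive_weight w" and "f \<noteq> 0" "g \<noteq> 0"
  shows "leading_form w (f * g) = leading_form w f * leading_form w g"
  by (metis assms component_mult_leading leading_form_def weighted_degree_mult)

text \<open>
  The lowest component of a product of nonzero polynomials is the product of the lowest
  components, and likewise for the highest ones. So the spread between highest and lowest degree
  is additive, and a homogeneous product forces homogeneous factors.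
\<close>
lemma homogeneous_factor:
  fixes f g :: "('n::finite, 'k::field) mpoly"
  assumes w: "additive_weight w" and h: "homogeneous w d (f * g)" and nz: "f * g \<noteq> 0"
  shows "homogeneous w (weighted_degree w f) f"
proof -
  have nz': "f \<noteq> 0" "g \<noteq> 0" using nz by auto
  define a b where "a = Min (w ` Poly_Mapping.keys f)" and "b = Min (w ` Poly_Mapping.keys g)"
  have a: "a \<in> w ` Poly_Mapping.keys f" and b: "b \<in> w ` Poly_Mapping.keys g"
    unfolding a_def b_def using nz' by (auto intro!: Min_in)
  have le: "m \<in> Poly_Mapping.keys f \<Longrightarrow> a \<le> w m" "m' \<in> Poly_Mapping.keys g \<Longrightarrow> b \<le> w m'" for m m'
    by (simp_all add: a_def b_def)
  have nza: "component w a f \<noteq> 0" and nzb: "component w b g \<noteq> 0"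
    using a b by (auto simp: keys_component simp flip: keys_eq_empty)
  have "component w (a + b) (f * g) = component w a f * component w b g"
  proof (rule component_mult_extremal[OF w])
    fix m m' assume "m \<in> Poly_Mapping.keys f" "m' \<in> Poly_Mapping.keys g" "w m + w m' = a + b"
    thus "w m = a \<and> w m' = b" using le(1)[of m] le(2)[of m'] by linarith
  qed
  hence "component w (a + b) (f * g) \<noteq> 0" using nza nzb by (simp add: mpoly_mult_eq_0_iff)
  hence "a + b = d" using h component_eq_0[of "f * g" w "a + b"] by (auto simp: homogeneous_def)
  moreover have "weighted_degree w f + weighted_degree w g = d"
    using weighted_degree_mult[OF w nz'] weighted_degree_homogeneous[OF h nz] by simp
  moreover have "a \<le> weighted_degree w f" "b \<le> weighted_degree w g"
    using a b weighted_degree_ge by fastforce+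
  ultimately have "a = weighted_degree w f" by linarith
  thus ?thesis unfolding homogeneous_def using le(1) weighted_degree_ge[of _ f w]
    by (metis antisym)
qed

section \<open>Polynomials in a subset of the variables\<close>

abbreviation degree_in :: "'n \<Rightarrow> ('n, 'k::zero) mpoly \<Rightarrow> nat" where
  "degree_in x \<equiv> weighted_degree (\<lambda>m. Poly_Mapping.lookup m x)"

abbreviation var_power :: "'n \<Rightarrow> nat \<Rightarrow> ('n, 'k::field) mpoly" where
  "var_power x a \<equiv> Poly_Mapping.single (Poly_Mapping.single x a) 1"

text \<open>
  Induction on the number of variables takes place inside one ring: the polynomials in
  the variables of \<open>V\<close> are a subring of the full polynomial ring.
\<close>
definition polys_in :: "'n set \<Rightarrow> ('n, 'k::zero) mpoly set" where
  "polys_in V = {f. \<forall>m\<in>Poly_Mapping.keys f. \<forall>i. i \<notin> V \<longrightarrow> Poly_Mapping.lookup m i = 0}"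

lemma polys_in_UNIV [simp]: "polys_in UNIV = UNIV"
  by (auto simp: polys_in_def)

lemma polys_in_mono: "V \<subseteq> W \<Longrightarrow> polys_in V \<subseteq> polys_in W"
  by (auto simp: polys_in_def)

lemma polys_in_insert: "f \<in> polys_in V \<Longrightarrow> f \<in> polys_in (insert x V)"
  by (auto simp: polys_in_def)

lemma polys_in_0 [simp]: "0 \<in> polys_in V"
  by (simp add: polys_in_def)

lemma polys_in_1 [simp]: "(1 :: ('n, 'k::field) mpoly) \<in> polys_in V"
  by (simp add: polys_in_def)

lemma polys_in_var_power: "x \<in> V \<Longrightarrow> var_power x a \<in> polys_in V"
  by (auto simp: polys_in_def lookup_single when_def)

lemma polys_in_add: "f \<in> polys_in V \<Longrightarrow> g \<in> polys_in V \<Longrightarrow> (f + g :: ('n, 'k::field) mpoly) \<in> polys_in V"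
  using keys_add[of f g] by (fastforce simp: polys_in_def)

lemma polys_in_diff: "f \<in> polys_in V \<Longrightarrow> g \<in> polys_in V \<Longrightarrow> (f - g :: ('n, 'k::field) mpoly) \<in> polys_in V"
  using keys_diff[of f g] by (fastforce simp: polys_in_def)

lemma polys_in_mult: "f \<in> polys_in V \<Longrightarrow> g \<in> polys_in V \<Longrightarrow> (f * g :: ('n, 'k::field) mpoly) \<in> polys_in V"
  using keys_mult[of f g] by (fastforce simp: polys_in_def lookup_add)

lemma polys_in_sum:
  "(\<And>i. i \<in> A \<Longrightarrow> f i \<in> polys_in V) \<Longrightarrow> (\<Sum>i\<in>A. f i :: ('n, 'k::field) mpoly) \<in> polys_in V"
  by (induction A rule: infinite_finite_induct) (auto intro: polys_in_add)

lemma polys_in_leading_form: "f \<in> polys_in V \<Longrightarrow> leading_form w f \<in> polys_in V"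
  by (auto simp: polys_in_def leading_form_def keys_component)

lemma polys_in_iff_degree_in: "f \<in> polys_in V \<longleftrightarrow> (\<forall>i. i \<notin> V \<longrightarrow> degree_in i f = 0)"
  by (auto simp: polys_in_def weighted_degree_def Max_eq_iff)

text \<open>
  The degree in a variable is additive, so a variable that does not occur in a nonzero product
  occurs in neither factor. Hence divisibility, units and irreducibility in these subrings are the
  same as in the full ring.
\<close>
lemma polys_in_factor:
  fixes f g :: "('n::finite, 'k::field) mpoly"
  assumes "f * g \<in> polys_in V" "f * g \<noteq> 0"
  shows "f \<in> polys_in V" "g \<in> polys_in V"
proof -
  have "f \<noteq> 0" "g \<noteq> 0" using assms(2) by auto
  hence "degree_in i (f * g) = degree_in i f + degree_in i g" for i
    by (rule weighted_degree_mult[OF additive_weight_exponent])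
  thus "f \<in> polys_in V" "g \<in> polys_in V"
    using assms(1) by (simp_all add: polys_in_iff_degree_in)
qed

lemma unit_iff_constant:
  fixes f :: "('n::finite, 'k::field) mpoly"
  shows "f dvd 1 \<longleftrightarrow> f \<noteq> 0 \<and> f \<in> polys_in {}"
proof
  assume "f dvd 1"
  then obtain g where "f * g = 1" by (metis dvdE)
  thus "f \<noteq> 0 \<and> f \<in> polys_in {}"
    using polys_in_factor[of f g "{}"] by auto
next
  assume f: "f \<noteq> 0 \<and> f \<in> polys_in {}"
  have "m = 0" if "m \<in> Poly_Mapping.keys f" for m
    using f that by (intro poly_mapping_eqI) (simp add: polys_in_def)
  hence eq: "f = Poly_Mapping.single 0 (Poly_Mapping.lookup f 0)"
    by (intro poly_mapping_eqI) (metis in_keys_iff lookup_single_eq lookup_single_not_eq)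
  moreover have "Poly_Mapping.lookup f 0 \<noteq> 0" using f eq by (metis single_zero)
  ultimately have "f * Poly_Mapping.single 0 (inverse (Poly_Mapping.lookup f 0)) = 1"
    by (metis mult_single add_0 right_inverse single_one)
  thus "f dvd 1" by (metis dvdI)
qed

lemma unit_iff_degree_0:
  fixes f :: "('n::finite, 'k::field) mpoly"
  assumes "f \<noteq> 0"
  shows "f dvd 1 \<longleftrightarrow> weighted_degree monom_deg f = 0"
proof -
  have "f \<in> polys_in {} \<longleftrightarrow> (\<forall>m\<in>Poly_Mapping.keys f. monom_deg m = 0)"
    by (auto simp: polys_in_def monom_deg_def)
  also have "\<dots> \<longleftrightarrow> weighted_degree monom_deg f = 0"
    by (auto simp: weighted_degree_def Max_eq_iff)
  finally show ?thesis using assms by (simp add: unit_iff_constant)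
qed

lemma degree_in_0:
  assumes "x \<notin> V" "f \<in> polys_in V"
  shows "degree_in x f = 0" and "homogeneous (\<lambda>m. Poly_Mapping.lookup m x) 0 f"
  using assms by (simp add: polys_in_iff_degree_in) (use assms in \<open>auto simp: homogeneous_def polys_in_def\<close>)

lemma extract_var_power:
  fixes f :: "('n::finite, 'k::field) mpoly"
  assumes x: "x \<notin> V" and f: "f \<in> polys_in (insert x V)"
    and hom: "homogeneous (\<lambda>m. Poly_Mapping.lookup m x) a f"
  obtains F where "F \<in> polys_in V" "f = F * var_power x a"
proof -
  \<comment> \<open>Divide every monomial by the power of \<open>x\<close> that it contains.\<close>
  define F where "F = (\<Sum>m\<in>Poly_Mapping.keys f.
    Poly_Mapping.single (m - Poly_Mapping.single x a) (Poly_Mapping.lookup f m))"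
  have m: "m - Poly_Mapping.single x a + Poly_Mapping.single x a = m"
    if "m \<in> Poly_Mapping.keys f" for m
    using that hom
    by (intro poly_mapping_eqI) (auto simp: lookup_add lookup_minus homogeneous_def lookup_single when_def)
  have "F * var_power x a = (\<Sum>m\<in>Poly_Mapping.keys f. Poly_Mapping.single m (Poly_Mapping.lookup f m))"
    by (simp add: F_def sum_distrib_right mult_single m cong: sum.cong)
  also have "\<dots> = f"
    by (rule poly_mapping_eqI)
      (simp add: lookup_sum lookup_single when_def in_keys_iff)
  finally have eq: "f = F * var_power x a" ..
  have "F \<in> polys_in V" unfolding F_def
  proof (rule polys_in_sum)
    fix m assume mk: "m \<in> Poly_Mapping.keys f"
    show "Poly_Mapping.single (m - Poly_Mapping.single x a) (Poly_Mapping.lookup f m) \<in> polys_in V"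
      using f hom mk by (auto simp: polys_in_def lookup_minus lookup_single when_def homogeneous_def)
  qed
  thus ?thesis using that eq by blast
qed

lemma leading_coefficient:
  fixes f :: "('n::finite, 'k::field) mpoly"
  assumes "x \<notin> V" "f \<in> polys_in (insert x V)" "f \<noteq> 0"
  obtains F where "F \<in> polys_in V" "F \<noteq> 0"
    "leading_form (\<lambda>m. Poly_Mapping.lookup m x) f = F * var_power x (degree_in x f)"
proof -
  let ?L = "leading_form (\<lambda>m. Poly_Mapping.lookup m x) f"
  obtain F where "F \<in> polys_in V" "?L = F * var_power x (degree_in x f)"
    using extract_var_power[OF assms(1) polys_in_leading_form[OF assms(2)]]
      homogeneous_component unfolding leading_form_def by metis
  thus ?thesis using that leading_form_nonzero[OF assms(3)] by force
qed

section \<open>Unique factorization\<close>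

text \<open>
  Primality, unlike irreducibility, is not obviously the same in the subring and in the full ring,
  because it tests products of more elements.
\<close>
definition prime_in :: "'n::finite set \<Rightarrow> ('n, 'k::field) mpoly \<Rightarrow> bool" where
  "prime_in V p \<longleftrightarrow> p \<in> polys_in V \<and> p \<noteq> 0 \<and> \<not> p dvd 1 \<and>
     (\<forall>a\<in>polys_in V. \<forall>b\<in>polys_in V. p dvd a * b \<longrightarrow> p dvd a \<or> p dvd b)"

text \<open>
  This is Gauss's lemma in the form that a prime element of \<open>R\<close> stays prime in \<open>R[x]\<close>. If \<open>p\<close> divides
  \<open>a b\<close>, then it divides the product of the leading coefficients, so one of them, say that
  of \<open>a\<close>. Removing the leading form of \<open>a\<close> leaves a product with fewer monomials in its factors, which \<open>p\<close> still divides.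
\<close>
lemma prime_in_insert:
  fixes p :: "('n::finite, 'k::field) mpoly"
  assumes p: "prime_in V p" and x: "x \<notin> V"
  shows "prime_in (insert x V) p"
proof -
  let ?w = "\<lambda>m. Poly_Mapping.lookup m x"
  let ?W = "polys_in (insert x V)"
  have pV: "p \<in> polys_in V" "p \<noteq> 0" using p by (auto simp: prime_in_def)
  have smaller: "card (Poly_Mapping.keys (h - leading_form ?w h)) < card (Poly_Mapping.keys h)"
    if "h \<noteq> 0" for h :: "('n, 'k) mpoly"
  proof (rule psubset_card_mono)
    obtain m where "m \<in> Poly_Mapping.keys h" "?w m = degree_in x h"
      using weighted_degree_attained[OF \<open>h \<noteq> 0\<close>] by metis
    thus "Poly_Mapping.keys (h - leading_form ?w h) \<subset> Poly_Mapping.keys h"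
      by (auto simp: in_keys_iff lookup_minus leading_form_def lookup_component split: if_splits)
  qed simp
  have "p dvd a \<or> p dvd b" if "a \<in> ?W" "b \<in> ?W" "p dvd a * b" for a b
    using that
  proof (induction "card (Poly_Mapping.keys a) + card (Poly_Mapping.keys b)" arbitrary: a b rule: less_induct)
    case less
    show ?case
    proof (cases "a = 0 \<or> b = 0")
      case False
      hence nz: "a \<noteq> 0" "b \<noteq> 0" by auto
      obtain q where q: "a * b = p * q" using less.prems(3) by (metis dvdE)
      have qnz: "q \<noteq> 0" using q nz by (metis mpoly_mult_eq_0_iff)
      have qW: "q \<in> ?W" using polys_in_factor(2)[of p q "insert x V"] polys_in_mult[OF less.prems(1,2)]
          q nz mpoly_mult_eq_0_iff by metis
      obtain A where A: "A \<in> polys_in V" "leading_form ?w a = A * var_power x (degree_in x a)"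
        using leading_coefficient[OF x less.prems(1) nz(1)] by metis
      obtain B where B: "B \<in> polys_in V" "leading_form ?w b = B * var_power x (degree_in x b)"
        using leading_coefficient[OF x less.prems(2) nz(2)] by metis
      obtain Q where Q: "Q \<in> polys_in V" "leading_form ?w q = Q * var_power x (degree_in x q)"
        using leading_coefficient[OF x qW qnz] by metis
      have deg: "degree_in x a + degree_in x b = degree_in x q"
        using weighted_degree_mult[OF additive_weight_exponent, of a b x] nz
          weighted_degree_mult[OF additive_weight_exponent, of p q x] pV(2) qnz q
          degree_in_0(1)[OF x pV(1)] by simp
      have "leading_form ?w p = p"
        using component_eq_self[OF degree_in_0(2)[OF x pV(1)]] degree_in_0(1)[OF x pV(1)]
        by (simp add: leading_form_def)
      hence "leading_form ?w a * leading_form ?w b = p * leading_form ?w q"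
        using leading_form_mult[OF additive_weight_exponent] nz pV(2) qnz q by metis
      hence "(A * B) * (var_power x (degree_in x a) * var_power x (degree_in x b))
             = (p * Q) * var_power x (degree_in x q)"
        unfolding A B Q by (simp add: ac_simps)
      hence "var_power x (degree_in x q) * (A * B) = var_power x (degree_in x q) * (p * Q)"
        by (simp add: mult_single deg ac_simps flip: single_add)
      hence "A * B = p * Q" by (subst (asm) mpoly_mult_left_cancel) (simp_all flip: keys_eq_empty)
      hence "p dvd A * B" by simp
      hence "p dvd A \<or> p dvd B" using p A B by (auto simp: prime_in_def)
      thus ?thesis
      proof
        assume "p dvd A"
        hence lead: "p dvd leading_form ?w a" using A by simp
        hence "p dvd (a - leading_form ?w a) * b"
          using less.prems(3) by (simp add: left_diff_distrib)
        hence "p dvd a - leading_form ?w a \<or> p dvd b"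
          using less.hyps[of "a - leading_form ?w a" b] smaller[OF nz(1)] less.prems
          by (simp add: polys_in_diff polys_in_leading_form)
        thus ?thesis using lead by (metis diff_add_cancel dvd_add)
      next
        assume "p dvd B"
        hence lead: "p dvd leading_form ?w b" using B by simp
        hence "p dvd a * (b - leading_form ?w b)"
          using less.prems(3) by (simp add: right_diff_distrib)
        hence "p dvd a \<or> p dvd b - leading_form ?w b"
          using less.hyps[of a "b - leading_form ?w b"] smaller[OF nz(2)] less.prems
          by (simp add: polys_in_diff polys_in_leading_form)
        thus ?thesis using lead by (metis diff_add_cancel dvd_add)
      qed
    qed auto
  qed
  thus ?thesis using p by (auto simp: prime_in_def polys_in_insert)
qed

inductive prime_product :: "'n::finite set \<Rightarrow> ('n, 'k::field) mpoly \<Rightarrow> bool" for V where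
  unit: "u dvd 1 \<Longrightarrow> prime_product V u"
| mult: "prime_in V p \<Longrightarrow> prime_product V f \<Longrightarrow> prime_product V (p * f)"

lemma prime_product_nonzero: "prime_product V f \<Longrightarrow> f \<noteq> 0"
  by (induction rule: prime_product.induct)
    (auto simp: unit_iff_constant mpoly_mult_eq_0_iff prime_in_def)

lemma prime_product_polys_in: "prime_product V f \<Longrightarrow> f \<in> polys_in V"
  by (induction rule: prime_product.induct)
    (auto simp: unit_iff_constant prime_in_def polys_in_mult intro: subsetD[OF polys_in_mono, of "{}"])

lemma prime_product_unit_mult:
  assumes "u dvd 1" "prime_product V f"
  shows "prime_product V (u * f)"
  using assms(2)
proof induction
  case (unit v)
  thus ?case using assms(1) by (metis prime_product.unit mult_dvd_mono mult_1)
next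
  case (mult p f)
  thus ?case using prime_product.mult[of V p "u * f"] by (simp add: ac_simps)
qed

lemma prime_product_mult:
  "prime_product V f \<Longrightarrow> prime_product V g \<Longrightarrow> prime_product V (f * g)"
  by (induction rule: prime_product.induct)
    (auto simp: mult.assoc intro: prime_product_unit_mult prime_product.mult)

lemma prime_product_insert:
  "prime_product V f \<Longrightarrow> x \<notin> V \<Longrightarrow> prime_product (insert x V) f"
  by (induction rule: prime_product.induct)
    (auto intro: prime_product.intros prime_in_insert)

text \<open>
  Each prime factor of \<open>e\<close> divides \<open>d\<close> or \<open>q\<close> and can be cancelled there. This is the cancellation of
  denominators that compares factorizations over the fraction field with those over the ring.
\<close>
lemma prime_product_distribute:
  fixes f :: "('n::finite, 'k::field) mpoly"
  assumes "prime_product V e" "e * f = d * q" "f \<noteq> 0" "d \<in> polys_in V" "q \<in> polys_in V"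
  shows "\<exists>d0 q0 e1 e2. d = e1 * d0 \<and> q = e2 * q0 \<and> e = e1 * e2 \<and> f = d0 * q0"
  using assms(1,2,4,5)
proof (induction arbitrary: d q rule: prime_product.induct)
  case (unit u)
  then obtain v where v: "1 = u * v" by (metis dvdE)
  have "d = u * (v * d)" using v by (simp add: mult.assoc[symmetric] flip: v)
  moreover have "f = (v * d) * q"
  proof -
    have "(v * d) * q = v * (u * f)" using unit.prems(1) by (simp add: mult.assoc)
    also have "\<dots> = (u * v) * f" by (simp only: ac_simps)
    finally show ?thesis using v by simp
  qed
  ultimately show ?case by (intro exI[of _ "v * d"] exI[of _ q] exI[of _ u] exI[of _ 1]) simp
next
  case (mult p e)
  have nz: "d * q \<noteq> 0"
    using mult.hyps mult.prems(1) assms(3) prime_product_nonzero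
    by (metis mpoly_mult_eq_0_iff prime_in_def)
  have pnz: "p \<noteq> 0" using mult.hyps by (simp add: prime_in_def)
  have "p dvd d * q" using mult.prems(1) by (metis dvd_triv_left mult.assoc)
  hence "p dvd d \<or> p dvd q" using mult.hyps mult.prems(2,3) by (simp add: prime_in_def)
  thus ?case
  proof
    assume "p dvd d"
    then obtain d' where d': "d = p * d'" by (metis dvdE)
    have "p * (e * f) = p * (d' * q)" using mult.prems(1) d' by (simp add: ac_simps)
    hence "e * f = d' * q" using pnz by (simp add: mpoly_mult_left_cancel)
    moreover have "d' \<in> polys_in V"
      using polys_in_factor(2)[of p d' V] mult.prems(2) d' nz by (metis mult_zero_left)
    ultimately obtain d0 q0 e1 e2 where "d' = e1 * d0" "q = e2 * q0" "e = e1 * e2" "f = d0 * q0"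
      using mult.IH mult.prems(3) by metis
    hence "d = (p * e1) * d0 \<and> q = e2 * q0 \<and> p * e = (p * e1) * e2 \<and> f = d0 * q0"
      using d' by (simp add: mult.assoc)
    thus ?thesis by blast
  next
    assume "p dvd q"
    then obtain q' where q': "q = p * q'" by (metis dvdE)
    have "p * (e * f) = p * (d * q')" using mult.prems(1) q' by (simp add: ac_simps)
    hence "e * f = d * q'" using pnz by (simp add: mpoly_mult_left_cancel)
    moreover have "q' \<in> polys_in V"
      using polys_in_factor(2)[of p q' V] mult.prems(3) q' nz by (metis mult_zero_right)
    ultimately obtain d0 q0 e1 e2 where "d = e1 * d0" "q' = e2 * q0" "e = e1 * e2" "f = d0 * q0"
      using mult.IH mult.prems(2) by metis
    hence "d = e1 * d0 \<and> q = (p * e2) * q0 \<and> p * e = e1 * (p * e2) \<and> f = d0 * q0"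
      using q' by (simp add: ac_simps)
    thus ?thesis by blast
  qed
qed

text \<open>
  No prime factor of the coefficient \<open>e\<close> is shared with \<open>f\<close>, as \<open>f\<close> is irreducible and involves \<open>x\<close>.
\<close>
lemma cancel_coefficient:
  fixes f :: "('n::finite, 'k::field) mpoly"
  assumes x: "x \<notin> V" and f: "Factorial_Ring.irreducible f" "f \<in> polys_in (insert x V)" "degree_in x f > 0"
    and e: "prime_product V e" and b: "b \<in> polys_in (insert x V)" and dvd: "f dvd e * b"
  shows "f dvd b"
proof (cases "b = 0")
  case False
  obtain t where t: "e * b = f * t" using dvd by (metis dvdE)
  have enz: "e \<noteq> 0" using prime_product_nonzero[OF e] .
  have eW: "e \<in> polys_in (insert x V)" using prime_product_polys_in[OF e] by (rule polys_in_insert)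
  have "t \<in> polys_in (insert x V)"
    using polys_in_factor(2)[of f t "insert x V"] polys_in_mult[OF eW b] t False enz
    by (metis mpoly_mult_eq_0_iff)
  then obtain f0 t0 e1 e2 where *: "f = e1 * f0" "t = e2 * t0" "e = e1 * e2" "b = f0 * t0"
    using prime_product_distribute[OF prime_product_insert[OF e x] t False f(2)] by metis
  have "e1 dvd 1 \<or> f0 dvd 1" using f(1) *(1) by (metis irreducibleD)
  moreover have "\<not> f0 dvd 1"
  proof
    assume "f0 dvd 1"
    hence f0: "f0 \<in> polys_in V" "f0 \<noteq> 0"
      using polys_in_mono[of "{}" V] by (auto simp: unit_iff_constant)
    have e1: "e1 \<in> polys_in V" "e1 \<noteq> 0"
      using polys_in_factor(1)[of e1 e2 V] prime_product_polys_in[OF e] enz *(3) by auto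
    have "degree_in x f = 0"
      using degree_in_0(1)[OF x polys_in_mult[OF e1(1) f0(1)]] *(1) by simp
    thus False using f(3) by simp
  qed
  ultimately obtain v where v: "e1 * v = 1" by (metis dvdE)
  have "f * v = (e1 * v) * f0" using *(1) by (simp only: ac_simps)
  hence "b = f * (v * t0)" using *(4) v by (simp add: mult.assoc[symmetric])
  thus ?thesis by simp
qed simp

lemma weighted_degree_diff_less:
  fixes f g :: "('n::finite, 'k::field) mpoly"
  assumes "weighted_degree w f \<le> n" "weighted_degree w g \<le> n"
    and "component w n f = component w n g" and "f - g \<noteq> 0"
  shows "weighted_degree w (f - g) < n"
proof -
  obtain m where m: "m \<in> Poly_Mapping.keys (f - g)" "w m = weighted_degree w (f - g)"
    using weighted_degree_attained[OF assms(4)] by metis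
  hence "m \<in> Poly_Mapping.keys f \<union> Poly_Mapping.keys g"
    by (auto simp: in_keys_iff lookup_minus)
  hence "w m \<le> n" using weighted_degree_ge[of m f w] weighted_degree_ge[of m g w] assms by auto
  moreover have "w m \<noteq> n"
    using m(1) arg_cong[OF assms(3), of "\<lambda>h. Poly_Mapping.lookup h m"]
    by (auto simp: in_keys_iff lookup_minus lookup_component)
  ultimately show ?thesis using m(2) by simp
qed

text \<open>
  Division by \<open>d\<close> in the variable \<open>x\<close> becomes possible after multiplication with the leading
  coefficient \<open>D\<close> of \<open>d\<close>; one step lowers the degree or leaves the remainder zero.
\<close>
lemma pseudo_division_step:
  fixes u d :: "('n::finite, 'k::field) mpoly"
  assumes x: "x \<notin> V" and u: "u \<in> polys_in (insert x V)" "u \<noteq> 0"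
    and d: "d \<in> polys_in (insert x V)" "d \<noteq> 0" and le: "degree_in x d \<le> degree_in x u"
  obtains D r where "D \<in> polys_in V" "D \<noteq> 0" "r \<in> polys_in (insert x V)"
    "D * u - r * d = 0 \<or> degree_in x (D * u - r * d) < degree_in x u"
proof -
  let ?w = "\<lambda>m. Poly_Mapping.lookup m x"
  let ?n = "degree_in x u - degree_in x d"
  obtain D where D: "D \<in> polys_in V" "D \<noteq> 0" "leading_form ?w d = D * var_power x (degree_in x d)"
    using leading_coefficient[OF x d] by metis
  obtain U where U: "U \<in> polys_in V" "U \<noteq> 0" "leading_form ?w u = U * var_power x (degree_in x u)"
    using leading_coefficient[OF x u] by metis
  let ?r = "U * var_power x ?n"
  have D_hom: "homogeneous ?w 0 D" and U_hom: "homogeneous ?w 0 U"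
    using degree_in_0(2)[OF x] D U by auto
  have "homogeneous ?w ?n (var_power x ?n :: ('n, 'k) mpoly)"
    by (simp add: homogeneous_def)
  hence r_hom: "homogeneous ?w ?n ?r"
    using homogeneous_mult[OF additive_weight_exponent U_hom] by fastforce
  have vp_nz: "var_power x a \<noteq> (0 :: ('n, 'k) mpoly)" for a
    by (simp flip: keys_eq_empty)
  have r_nz: "?r \<noteq> 0" using U(2) vp_nz by (simp add: mpoly_mult_eq_0_iff)
  have D_lead: "leading_form ?w D = D" and D_deg: "degree_in x D = 0"
    and r_lead: "leading_form ?w ?r = ?r" and r_deg: "degree_in x ?r = ?n"
    using weighted_degree_homogeneous[OF D_hom D(2)] weighted_degree_homogeneous[OF r_hom r_nz]
      component_eq_self[OF D_hom] component_eq_self[OF r_hom]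
    by (simp_all add: leading_form_def)
  have 1: "degree_in x (D * u) = degree_in x u"
    using weighted_degree_mult[OF additive_weight_exponent D(2) u(2)] D_deg by simp
  have 2: "degree_in x (?r * d) = degree_in x u"
    using weighted_degree_mult[OF additive_weight_exponent r_nz d(2)] r_deg le by simp
  have "component ?w (degree_in x u) (D * u) = leading_form ?w (D * u)"
    using 1 by (simp add: leading_form_def)
  also have "\<dots> = D * (U * var_power x (degree_in x u))"
    using leading_form_mult[OF additive_weight_exponent D(2) u(2)] D_lead U(3) by simp
  also have "\<dots> = ?r * (D * var_power x (degree_in x d))"
    using le by (simp add: mult_single ac_simps flip: single_add)
  also have "\<dots> = leading_form ?w (?r * d)"
    using leading_form_mult[OF additive_weight_exponent r_nz d(2)] r_lead D(3) by simp
  also have "\<dots> = component ?w (degree_in x u) (?r * d)"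
    using 2 by (simp add: leading_form_def)
  finally have 3: "component ?w (degree_in x u) (D * u) = component ?w (degree_in x u) (?r * d)" .
  have "D * u - ?r * d = 0 \<or> degree_in x (D * u - ?r * d) < degree_in x u"
    using weighted_degree_diff_less[OF _ _ 3] 1 2 by auto
  moreover have "?r \<in> polys_in (insert x V)"
    using U by (intro polys_in_mult polys_in_insert polys_in_var_power) auto
  ultimately show ?thesis using that D by blast
qed

text \<open>
  Over the fraction field of the coefficient ring the ideal \<open>(f, b)\<close> is principal, generated by an
  element of least degree in \<open>x\<close>. Clearing denominators gives the version stated here.
\<close>
lemma generator_up_to_coefficients:
  fixes f b :: "('n::finite, 'k::field) mpoly"
  assumes x: "x \<notin> V" and f: "f \<in> polys_in (insert x V)" "f \<noteq> 0" and b: "b \<in> polys_in (insert x V)"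
  defines "J \<equiv> {f * s + b * t | s t. s \<in> polys_in (insert x V) \<and> t \<in> polys_in (insert x V)}"
  obtains d where "d \<in> J" "d \<noteq> 0"
    "\<And>u. u \<in> J \<Longrightarrow> \<exists>e\<in>polys_in V. e \<noteq> 0 \<and> d dvd e * u"
proof -
  let ?W = "polys_in (insert x V)"
  have fJ: "f \<in> J" unfolding J_def using polys_in_1 polys_in_0 by (fastforce intro: exI[of _ 1] exI[of _ 0])
  have JW: "J \<subseteq> ?W" using f b by (auto simp: J_def intro!: polys_in_add polys_in_mult)
  \<comment> \<open>Pseudo-division does not leave the ideal.\<close>
  have J_comb: "h * u - r * v \<in> J" if "h \<in> ?W" "r \<in> ?W" "u \<in> J" "v \<in> J" for h r u v
  proof -
    obtain s t where u: "u = f * s + b * t" "s \<in> ?W" "t \<in> ?W"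
      using \<open>u \<in> J\<close> unfolding J_def by blast
    obtain s' t' where v: "v = f * s' + b * t'" "s' \<in> ?W" "t' \<in> ?W"
      using \<open>v \<in> J\<close> unfolding J_def by blast
    have "h * u - r * v = f * (h * s - r * s') + b * (h * t - r * t')"
      by (simp add: u(1) v(1) algebra_simps)
    moreover have "h * s - r * s' \<in> ?W" "h * t - r * t' \<in> ?W"
      using u v that by (auto intro!: polys_in_mult polys_in_diff)
    ultimately show ?thesis unfolding J_def by blast
  qed
  obtain d where d: "d \<in> J" "d \<noteq> 0" and min: "\<And>u. u \<in> J \<Longrightarrow> u \<noteq> 0 \<Longrightarrow> degree_in x d \<le> degree_in x u"
    using ex_has_least_nat[of "\<lambda>u. u \<in> J \<and> u \<noteq> 0" f "degree_in x"] fJ f(2) by blast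
  have "\<exists>e\<in>polys_in V. e \<noteq> 0 \<and> d dvd e * u" if "u \<in> J" for u
    using that
  proof (induction "degree_in x u" arbitrary: u rule: less_induct)
    case less
    show ?case
    proof (cases "u = 0")
      case True
      thus ?thesis by (intro bexI[of _ 1]) auto
    next
      case False
      have uW: "u \<in> ?W" and dW: "d \<in> ?W" using JW less.prems d(1) by auto
      obtain D r where D: "D \<in> polys_in V" "D \<noteq> 0" "r \<in> ?W"
        "D * u - r * d = 0 \<or> degree_in x (D * u - r * d) < degree_in x u"
        using pseudo_division_step[OF x uW False dW d(2) min[OF less.prems False]] by metis
      have "D * u - r * d \<in> J"
        by (rule J_comb[OF polys_in_insert[OF D(1)] D(3) less.prems d(1)])
      obtain e where e: "e \<in> polys_in V" "e \<noteq> 0" "d dvd e * (D * u - r * d)"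
        using D(4)
      proof
        assume "D * u - r * d = 0"
        thus ?thesis using that[of 1] by simp
      next
        assume "degree_in x (D * u - r * d) < degree_in x u"
        thus ?thesis using less.hyps[of "D * u - r * d"] \<open>D * u - r * d \<in> J\<close> that by metis
      qed
      have "e * (D * u - r * d) + d * (e * r) = (e * D) * u" by (simp add: algebra_simps)
      hence "d dvd (e * D) * u" using e(3) by (metis dvd_add dvd_triv_left)
      thus ?thesis using e D by (intro bexI[of _ "e * D"]) (auto simp: mpoly_mult_eq_0_iff polys_in_mult)
    qed
  qed
  thus ?thesis using that d by blast
qed

text \<open>
  Let \<open>f\<close> divide \<open>b c\<close> and let \<open>d\<close> generate \<open>(f, b)\<close> up to coefficients. Cancelling coefficients turns
  \<open>d\<close> into a divisor of \<open>f\<close>, which is therefore a unit or an associate of \<open>f\<close>. If it is an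
  associate, then \<open>f\<close> divides \<open>b\<close> up to a coefficient. If it is a unit, then \<open>d\<close> is itself a
  coefficient, and \<open>d c\<close> is a combination of \<open>f c\<close> and \<open>b c\<close>, so \<open>f\<close> divides \<open>c\<close> up to a coefficient.
  In both cases the coefficient can be cancelled.
\<close>
lemma irreducible_imp_prime_in:
  fixes f :: "('n::finite, 'k::field) mpoly"
  assumes x: "x \<notin> V" and factorial: "\<And>e. e \<in> polys_in V \<Longrightarrow> e \<noteq> 0 \<Longrightarrow> prime_product V (e :: ('n, 'k) mpoly)"
    and f: "Factorial_Ring.irreducible f" "f \<in> polys_in (insert x V)" "degree_in x f > 0"
  shows "prime_in (insert x V) f"
proof -
  let ?W = "polys_in (insert x V)"
  have fnz: "f \<noteq> 0" using f(1) by auto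
  have "f dvd b \<or> f dvd c" if b: "b \<in> ?W" and c: "c \<in> ?W" and bc: "f dvd b * c" for b c
  proof (cases "b = 0")
    case bnz: False
    obtain d s t where d: "d \<noteq> 0" "d = f * s + b * t" and st: "s \<in> ?W" "t \<in> ?W"
      and gen: "\<And>u. u \<in> {f * s + b * t | s t. s \<in> ?W \<and> t \<in> ?W} \<Longrightarrow> \<exists>e\<in>polys_in V. e \<noteq> 0 \<and> d dvd e * u"
      using generator_up_to_coefficients[OF x f(2) fnz b] by (smt (verit) mem_Collect_eq)
    have dW: "d \<in> ?W" unfolding d(2) using st f(2) b by (intro polys_in_add polys_in_mult)
    have "f = f * 1 + b * 0" "b = f * 0 + b * 1" by simp_all
    hence fb: "f \<in> {f * s + b * t | s t. s \<in> ?W \<and> t \<in> ?W}" "b \<in> {f * s + b * t | s t. s \<in> ?W \<and> t \<in> ?W}"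
      using polys_in_0 polys_in_1 by blast+
    obtain e q where e: "e \<in> polys_in V" "e \<noteq> 0" "e * f = d * q"
      using gen[OF fb(1)] by (metis dvdE)
    obtain e' where e': "e' \<in> polys_in V" "e' \<noteq> 0" "d dvd e' * b"
      using gen[OF fb(2)] by metis
    have "q \<in> ?W"
      using polys_in_factor(2)[of d q "insert x V"] polys_in_mult[OF polys_in_insert[OF e(1)] f(2)] e fnz
      by (metis mpoly_mult_eq_0_iff)
    then obtain d0 q0 e1 e2 where *: "d = e1 * d0" "q = e2 * q0" "e = e1 * e2" "f = d0 * q0"
      using prime_product_distribute[OF prime_product_insert[OF factorial[OF e(1,2)] x] e(3) fnz dW]
      by metis
    have "d0 dvd 1 \<or> q0 dvd 1" using f(1) *(4) by (metis irreducibleD)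
    thus ?thesis
    proof
      assume "d0 dvd 1"
      hence "d0 \<in> polys_in V" using polys_in_mono[of "{}" V] by (auto simp: unit_iff_constant)
      moreover have "e1 \<in> polys_in V" using polys_in_factor(1)[of e1 e2 V] e *(3) by simp
      ultimately have dV: "d \<in> polys_in V" using *(1) by (simp add: polys_in_mult)
      have "d * c = f * (s * c) + t * (b * c)" unfolding d(2) by (simp add: algebra_simps)
      hence "f dvd d * c" using bc by (metis dvd_add dvd_triv_left dvd_mult)
      thus ?thesis using cancel_coefficient[OF x f factorial[OF dV d(1)] c] by blast
    next
      assume "q0 dvd 1"
      then obtain v where "q0 * v = 1" by (metis dvdE)
      hence "d0 = f * v" using *(4) by (simp add: mult.assoc)
      hence "f dvd d" using *(1) by simp
      hence "f dvd e' * b" using e'(3) by (rule dvd_trans)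
      thus ?thesis using cancel_coefficient[OF x f factorial[OF e'(1,2)] b] by blast
    qed
  qed auto
  thus ?thesis using f fnz by (auto simp: prime_in_def irreducible_not_unit)
qed

text \<open>
  Irreducible factorizations exist because the total degree drops; the irreducible factors are prime
  by induction if they do not involve the new variable, and by
  \<open>irreducible_imp_prime_in\<close> otherwise.
\<close>
theorem polys_in_factorial:
  fixes f :: "('n::finite, 'k::field) mpoly"
  assumes "finite V" "f \<in> polys_in V" "f \<noteq> 0"
  shows "prime_product V f"
  using assms
proof (induction V arbitrary: f rule: finite_induct)
  case empty
  thus ?case by (intro prime_product.unit) (simp add: unit_iff_constant)
next
  case (insert x V)
  show ?case using insert.prems
  proof (induction "weighted_degree monom_deg f" arbitrary: f rule: less_induct)
    case less
    consider "f dvd 1" | a b where "f = a * b" "\<not> a dvd 1" "\<not> b dvd 1"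
      | "Factorial_Ring.irreducible f"
      using less.prems(2) by (metis irreducibleI)
    thus ?case
    proof cases
      case 1
      thus ?thesis by (rule prime_product.unit)
    next
      case 2
      have nz: "a \<noteq> 0" "b \<noteq> 0" using less.prems(2) 2(1) by auto
      have "weighted_degree monom_deg f = weighted_degree monom_deg a + weighted_degree monom_deg b"
        using weighted_degree_mult[OF additive_weight_monom_deg nz] 2(1) by simp
      moreover have "weighted_degree monom_deg a > 0" "weighted_degree monom_deg b > 0"
        using 2 nz unit_iff_degree_0 by auto
      moreover have "a \<in> polys_in (insert x V)" "b \<in> polys_in (insert x V)"
        using polys_in_factor[of a b "insert x V"] less.prems 2(1) by auto
      ultimately show ?thesis
        using less.hyps[of a] less.hyps[of b] nz 2(1) by (simp add: prime_product_mult)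
    next
      case 3
      show ?thesis
      proof (cases "degree_in x f = 0")
        case True
        hence "f \<in> polys_in V"
          using less.prems(1) by (simp add: polys_in_iff_degree_in) (use True in metis)
        thus ?thesis using insert.IH insert.hyps less.prems(2) prime_product_insert by blast
      next
        case False
        hence "prime_in (insert x V) f"
          using irreducible_imp_prime_in[OF insert.hyps(2) insert.IH 3 less.prems(1)] by blast
        hence "prime_product (insert x V) (f * 1)"
          by (rule prime_product.mult) (simp add: prime_product.unit)
        thus ?thesis by simp
      qed
    qed
  qed
qed

lemma prime_in_UNIV: "prime_in UNIV p \<longleftrightarrow> prime_elem p"
  by (auto simp: prime_in_def prime_elem_def)

section \<open>Associated primes of a principal ideal\<close>

lemma mpoly_mult_right_cancel_dvd:
  fixes a b c :: "('n::finite, 'k::field) mpoly"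
  assumes "c \<noteq> 0"
  shows "a * c dvd b * c \<longleftrightarrow> a dvd b"
proof
  assume "a * c dvd b * c"
  then obtain t where "b * c = a * c * t" by (metis dvdE)
  hence "c * b = c * (a * t)" by (simp add: ac_simps)
  thus "a dvd b" using assms by (simp add: mpoly_mult_left_cancel)
qed (rule mult_dvd_mono, auto)

lemma cring_class_ring: "cring (class_ring :: 'a::comm_ring_1 ring)"
  by (rule class_cring.cring_axioms)

lemma ring_class_ring: "ring (class_ring :: 'a::comm_ring_1 ring)"
  by (rule cring.axioms(1)[OF cring_class_ring])

lemma genideal_singleton:
  "genideal class_ring {h} = {f :: 'a::comm_ring_1. h dvd f}"
proof -
  have "genideal class_ring {h} = cgenideal class_ring h"
    by (rule cring.cgenideal_eq_genideal[OF cring_class_ring, symmetric]) simp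
  thus ?thesis by (auto simp: cgenideal_def dvd_def mult.commute)
qed

lemma ideal_multiples: "ideal {f :: 'a::comm_ring_1. h dvd f} class_ring"
  using ring.genideal_ideal[OF ring_class_ring, of "{h}"] by (simp add: genideal_singleton)

lemma ideal_power_multiples:
  "ideal_power {f :: ('n::finite, 'k::field) mpoly. g dvd f} k = {f. g ^ k dvd f}"
proof (induction k)
  case 0
  thus ?case by (simp add: nat_pow_def ideals_set_def)
next
  case (Suc k)
  have "f \<in> ideal_prod class_ring {f. g ^ k dvd f} {f. g dvd f} \<longleftrightarrow> g ^ Suc k dvd f" for f
  proof
    assume "f \<in> ideal_prod class_ring {f. g ^ k dvd f} {f. g dvd f}"
    thus "g ^ Suc k dvd f"
    proof induction
      case (prod i j)
      thus ?case by (simp add: mult_dvd_mono mult.commute[of g])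
    qed simp
  next
    assume "g ^ Suc k dvd f"
    then obtain t where "f = g ^ Suc k * t" by (metis dvdE)
    hence "f = g ^ k * (g * t)" by (simp add: ac_simps)
    thus "f \<in> ideal_prod class_ring {f. g ^ k dvd f} {f. g dvd f}"
      using ideal_prod.prod[of "g ^ k" "{f. g ^ k dvd f}" "g * t" "{f. g dvd f}" class_ring] by simp
  qed
  thus ?case using Suc by (auto simp: nat_pow_def ideals_set_def)
qed

lemma primeideal_multiples:
  assumes "prime_elem (p :: 'a::comm_ring_1)"
  shows "primeideal {f. p dvd f} class_ring"
proof (rule primeidealI[OF ideal_multiples cring_class_ring])
  show "carrier class_ring \<noteq> {f. p dvd f}"
    using assms by (auto simp: prime_elem_def)
qed (use assms in \<open>auto simp: prime_elem_def\<close>)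

lemma primeideal_not_UNIV: "primeideal P class_ring \<Longrightarrow> P \<noteq> UNIV"
  using primeideal.I_notcarr[of P class_ring] by auto

text \<open>
  A prime ideal that contains a product of primes contains one of them. This is where
  factoriality makes the associated primes of a principal ideal principal.
\<close>
lemma prime_divisor_in_primeideal:
  fixes h :: "('n::finite, 'k::field) mpoly"
  assumes "prime_product UNIV h" "primeideal P class_ring" "h \<in> P"
  shows "\<exists>p\<in>P. prime_elem p \<and> p dvd h"
  using assms(1,3)
proof induction
  case (unit u)
  interpret primeideal P class_ring by fact
  obtain v where "1 = u * v" using unit by (metis dvdE)
  hence "f = (f * v) * u" for f by (metis mult.assoc mult.commute mult_1_right)
  hence "f \<in> P" for f using I_l_closed[OF unit(2), of "f * v"] by simp
  thus ?case using primeideal_not_UNIV[OF assms(2)] by auto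
next
  case (mult p f)
  have "p \<in> P \<or> f \<in> P"
    using primeideal.I_prime[OF assms(2), of p f] mult.prems by simp
  moreover have "prime_elem p" using mult.hyps(1) by (simp add: prime_in_UNIV)
  ultimately show ?case using mult.IH by (metis dvd_mult dvd_triv_left)
qed

lemma colon_cofactor:
  fixes p c :: "('n::finite, 'k::field) mpoly"
  assumes "c \<noteq> 0"
  shows "colon {f. p * c dvd f} c = {f. p dvd f}"
  using assms by (auto simp: colon_def mpoly_mult_right_cancel_dvd)

text \<open>
  Together with \<open>colon_cofactor\<close> this says that the cofactor \<open>c\<close> of \<open>p\<close> is, up to multiples, the only
  witness for \<open>p\<close>; so it has the least degree among all witnesses.
\<close>
lemma cofactor_dvd_if_colon:
  fixes p c f :: "('n::finite, 'k::field) mpoly"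
  assumes "p \<noteq> 0" "p \<in> colon {f. p * c dvd f} f"
  shows "c dvd f"
  using assms mpoly_mult_right_cancel_dvd[of p c f] by (simp add: colon_def mult.commute)

text \<open>
  Let \<open>P = ((h) : f)\<close> be prime. It contains \<open>h\<close>, so it contains a prime factor \<open>p\<close> of \<open>h = p c\<close>. Then
  \<open>p f\<close> is a multiple of \<open>p c\<close>, so \<open>f = c t\<close> and \<open>P = ((p) : t)\<close>, which is \<open>(p)\<close> because \<open>p\<close> is prime and
  does not divide \<open>t\<close>.
\<close>
theorem Ass_multiples:
  fixes h :: "('n::finite, 'k::field) mpoly"
  assumes "h \<noteq> 0"
  shows "Ass {f. h dvd f} = (\<lambda>p. {f. p dvd f}) ` {p. prime_elem p \<and> p dvd h}"
proof (intro Set.set_eqI iffI)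
  fix P assume "P \<in> Ass {f. h dvd f}"
  then obtain f where P: "primeideal P class_ring" and Pf: "P = colon {f. h dvd f} f"
    by (auto simp: Ass_def)
  have "h \<in> P" by (simp add: Pf colon_def)
  then obtain p where p: "p \<in> P" "prime_elem p" "p dvd h"
    using prime_divisor_in_primeideal[OF polys_in_factorial P] assms by auto
  obtain c where c: "h = p * c" using p(3) by (metis dvdE)
  have pc: "p \<noteq> 0" "c \<noteq> 0" using c assms by auto
  obtain t where t: "f = c * t"
    using cofactor_dvd_if_colon[OF pc(1), of c f] p(1) Pf c by (metis dvdE)
  have "g * f = (g * t) * c" for g by (simp add: t ac_simps)
  hence P': "P = {g. p dvd g * t}"
    by (simp add: Pf c colon_def mpoly_mult_right_cancel_dvd[OF pc(2)])
  have "\<not> p dvd t" using P' primeideal_not_UNIV[OF P] by auto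
  hence "P = {g. p dvd g}" using p(2) unfolding P' prime_elem_def by (metis dvd_mult2)
  thus "P \<in> (\<lambda>p. {f. p dvd f}) ` {p. prime_elem p \<and> p dvd h}" using p by auto
next
  fix P assume "P \<in> (\<lambda>p. {f. p dvd f}) ` {p. prime_elem p \<and> p dvd h}"
  then obtain p where p: "prime_elem p" "p dvd h" "P = {f. p dvd f}" by auto
  obtain c where c: "h = p * c" using p(2) by (metis dvdE)
  hence "c \<noteq> 0" using assms by auto
  hence "P = colon {f. h dvd f} c" using colon_cofactor[of c p] p(3) c by simp
  thus "P \<in> Ass {f. h dvd f}" using primeideal_multiples[OF p(1)] p(3) by (auto simp: Ass_def)
qed

text \<open>
  A prime divisor of \<open>p f\<close> with \<open>p\<close> prime divides \<open>f\<close> or \<open>p\<close>, and in the second case it is an associate of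
  \<open>p\<close>. So each factor in a prime factorization contributes at most one ideal.
\<close>
lemma finite_Ass_multiples:
  fixes h :: "('n::finite, 'k::field) mpoly"
  assumes "h \<noteq> 0"
  shows "finite (Ass {f. h dvd f})"
proof -
  have "prime_product UNIV h" using polys_in_factorial[of UNIV h] assms by simp
  hence "finite ((\<lambda>p. {f. p dvd f}) ` {p. prime_elem p \<and> p dvd h})"
  proof induction
    case (unit u)
    hence none: "{p. prime_elem p \<and> p dvd u} = {}"
      by (auto simp: prime_elem_def dest: dvd_trans)
    show ?case unfolding none by simp
  next
    case (mult p f)
    have p: "prime_elem p" using mult by (simp add: prime_in_UNIV)
    have "{g. q dvd g} = {g. p dvd g}" if q: "prime_elem q" "q dvd p" for q
    proof -
      obtain s where s: "p = q * s" using q by (metis dvdE)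
      have "\<not> p dvd s"
      proof
        assume "p dvd s"
        hence "q * s dvd 1 * s" using s by simp
        moreover have "s \<noteq> 0" using s p by auto
        ultimately have "q dvd 1" using mpoly_mult_right_cancel_dvd by blast
        thus False using q(1) by (simp add: prime_elem_def)
      qed
      hence "p dvd q" using p s unfolding prime_elem_def by (metis dvd_refl)
      thus ?thesis using q(2) by (auto dest: dvd_trans)
    qed
    hence "(\<lambda>p. {f. p dvd f}) ` {q. prime_elem q \<and> q dvd p * f}
        \<subseteq> insert {g. p dvd g} ((\<lambda>p. {f. p dvd f}) ` {q. prime_elem q \<and> q dvd f})"
      by (auto simp: prime_elem_def)
    thus ?case by (rule finite_subset) (simp add: mult.IH)
  qed
  thus ?thesis using Ass_multiples[OF assms] by simp
qed

lemma Ass_multiples_nonempty: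
  fixes h :: "('n::finite, 'k::field) mpoly"
  assumes "h \<noteq> 0" "\<not> h dvd 1"
  shows "Ass {f. h dvd f} \<noteq> {}"
proof -
  have "prime_product UNIV h" using polys_in_factorial[of UNIV h] assms by simp
  hence "\<exists>p. prime_elem p \<and> p dvd h"
    using assms(2) by (cases rule: prime_product.cases) (auto simp: prime_in_UNIV)
  thus ?thesis by (auto simp: Ass_multiples[OF assms(1)])
qed

lemma Ass_multiples_power:
  fixes g :: "('n::finite, 'k::field) mpoly"
  assumes "g \<noteq> 0" "k \<ge> 1"
  shows "Ass {f. g ^ k dvd f} = Ass {f. g dvd f}"
proof -
  have "p dvd g ^ k \<longleftrightarrow> p dvd g" if "prime_elem p" for p
    using prime_elem_dvd_power[OF that] dvd_power[of k g] assms(2) by (auto intro: dvd_trans)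
  thus ?thesis using mpoly_power_nonzero[OF assms(1)] assms(1)
    by (auto simp: Ass_multiples)
qed

section \<open>Degrees of colon witnesses\<close>

abbreviation total_degree :: "('n::finite, 'k::zero) mpoly \<Rightarrow> nat" where
  "total_degree \<equiv> weighted_degree monom_deg"

text \<open>
  The total degree is the only degree in which a nonzero polynomial can be homogeneous.
\<close>
abbreviation is_homogeneous :: "('n::finite, 'k::zero) mpoly \<Rightarrow> bool" where
  "is_homogeneous f \<equiv> homogeneous monom_deg (total_degree f) f"

lemma graded_part_iff:
  assumes "f \<noteq> 0"
  shows "f \<in> graded_part (int d) \<longleftrightarrow> is_homogeneous f \<and> total_degree f = d"
  using assms weighted_degree_homogeneous[of monom_deg d f] graded_part_iff_homogeneous by auto

lemma total_degree_mult:
  fixes f g :: "('n::finite, 'k::field) mpoly"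
  assumes "f \<noteq> 0" "g \<noteq> 0"
  shows "total_degree (f * g) = total_degree f + total_degree g"
  by (rule weighted_degree_mult[OF additive_weight_monom_deg assms])

lemma total_degree_power:
  fixes g :: "('n::finite, 'k::field) mpoly"
  assumes "g \<noteq> 0"
  shows "total_degree (g ^ k) = k * total_degree g"
proof (induction k)
  case 0
  show ?case using unit_iff_degree_0[of 1] by simp
next
  case (Suc k)
  thus ?case using assms by (simp add: total_degree_mult mpoly_power_nonzero)
qed

lemma is_homogeneous_factor:
  fixes f g :: "('n::finite, 'k::field) mpoly"
  assumes "is_homogeneous (f * g)" "f * g \<noteq> 0"
  shows "is_homogeneous f" "is_homogeneous g"
  using homogeneous_factor[OF additive_weight_monom_deg, of _ f g]
    homogeneous_factor[OF additive_weight_monom_deg, of _ g f] assms by (auto simp: mult.commute)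

lemma is_homogeneous_mult:
  fixes f g :: "('n::finite, 'k::field) mpoly"
  assumes "is_homogeneous f" "is_homogeneous g"
  shows "is_homogeneous (f * g)"
  using homogeneous_mult[OF additive_weight_monom_deg assms] total_degree_mult[of f g]
  by (cases "f = 0 \<or> g = 0") (auto simp: homogeneous_def)

lemma is_homogeneous_power:
  fixes g :: "('n::finite, 'k::field) mpoly"
  shows "is_homogeneous g \<Longrightarrow> is_homogeneous (g ^ k)"
proof (induction k)
  case 0
  show ?case using additive_weight_0[OF additive_weight_monom_deg]
    by (simp add: homogeneous_def weighted_degree_def)
qed (simp add: is_homogeneous_mult)

lemma initial_degree_multiples:
  fixes h :: "('n::finite, 'k::field) mpoly"
  assumes "h \<noteq> 0" "is_homogeneous h"
  shows "initial_degree {f. h dvd f} = total_degree h"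
  unfolding initial_degree_def
proof (rule Least_equality)
  show "\<exists>f\<in>{f. h dvd f} - {0}. f \<in> graded_part (int (total_degree h))"
    using assms by (auto simp: graded_part_iff)
next
  fix d assume "\<exists>f\<in>{f. h dvd f} - {0}. f \<in> graded_part (int d)"
  then obtain f where f: "h dvd f" "f \<noteq> 0" "f \<in> graded_part (int d)" by auto
  then obtain q where q: "f = h * q" by (metis dvdE)
  hence "q \<noteq> 0" using f(2) by auto
  moreover have "d = total_degree f" using f(2,3) by (simp add: graded_part_iff)
  ultimately show "total_degree h \<le> d" using q total_degree_mult[of h q] assms(1) by simp
qed

text \<open>
  A witness for \<open>(p)\<close> is a nonzero multiple of \<open>h / p\<close>.
\<close>
lemma degree_of_colon_witness:
  fixes h p :: "('n::finite, 'k::field) mpoly"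
  assumes h: "h \<noteq> 0" and p: "\<not> p dvd 1" "p dvd h"
    and f: "f \<in> graded_part (int d)" "colon {f. h dvd f} f = {f. p dvd f}"
  shows "total_degree h \<le> d + total_degree p"
proof -
  obtain c where c: "h = p * c" using p(2) by (metis dvdE)
  have nz: "p \<noteq> 0" "c \<noteq> 0" using c h by auto
  have "p \<in> colon {f. p * c dvd f} f" using f(2) c by simp
  hence "c dvd f" by (rule cofactor_dvd_if_colon[OF nz(1)])
  then obtain t where t: "f = c * t" by (metis dvdE)
  have "1 \<notin> colon {f. h dvd f} f" using f(2) p(1) by simp
  hence fnz: "f \<noteq> 0" by (auto simp: colon_def)
  hence "t \<noteq> 0" using t by auto
  moreover have "d = total_degree f" using fnz f(1) by (simp add: graded_part_iff)
  ultimately have "total_degree c \<le> d" using total_degree_mult[of c t] nz t by simp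
  thus ?thesis using total_degree_mult[OF nz] c by simp
qed

lemma colon_witness:
  fixes h p :: "('n::finite, 'k::field) mpoly"
  assumes h: "h \<noteq> 0" "is_homogeneous h" and p: "p dvd h"
  shows "\<exists>f\<in>graded_part (int (total_degree h - total_degree p)). colon {f. h dvd f} f = {f. p dvd f}"
    and "total_degree p \<le> total_degree h"
proof -
  obtain c where c: "h = p * c" using p by (metis dvdE)
  have nz: "p \<noteq> 0" "c \<noteq> 0" using c h by auto
  have "c \<in> graded_part (int (total_degree h - total_degree p))"
    using is_homogeneous_factor(2)[of p c] h c nz total_degree_mult[OF nz] by (simp add: graded_part_iff)
  thus "\<exists>f\<in>graded_part (int (total_degree h - total_degree p)). colon {f. h dvd f} f = {f. p dvd f}"
    using colon_cofactor[OF nz(2), of p] c by blast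
  show "total_degree p \<le> total_degree h" using total_degree_mult[OF nz] c by simp
qed

lemma local_v_number_multiples:
  fixes h p :: "('n::finite, 'k::field) mpoly"
  assumes h: "h \<noteq> 0" "is_homogeneous h" and p: "\<not> p dvd 1" "p dvd h"
  shows "local_v_number {f. p dvd f} {f. h dvd f} = total_degree h - total_degree p"
  unfolding local_v_number_def
proof (rule Least_equality)
  show "\<exists>f\<in>graded_part (int (total_degree h - total_degree p)). colon {f. h dvd f} f = {f. p dvd f}"
    by (rule colon_witness(1)[OF h p(2)])
next
  fix d assume "\<exists>f\<in>graded_part (int d). colon {f. h dvd f} f = {f. p dvd f}"
  thus "total_degree h - total_degree p \<le> d"
    using degree_of_colon_witness[OF h(1) p] by (metis le_diff_conv)
qed

text \<open>
  The v-number is the least of the local ones, \<open>deg h - deg p\<close>, so it belongs to a prime factor \<open>p\<close> of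
  largest degree.
\<close>
lemma v_number_multiples:
  fixes h :: "('n::finite, 'k::field) mpoly"
  assumes h: "h \<noteq> 0" "is_homogeneous h" "\<not> h dvd 1"
  shows "v_number {f. h dvd f} + max_initial_degree {f. h dvd f} = total_degree h"
proof -
  let ?I = "{f. h dvd f}"
  let ?M = "max_initial_degree ?I"
  have in_deg: "initial_degree {f. p dvd f} = total_degree p" if p: "p dvd h" for p
  proof -
    obtain c where c: "h = p * c" using p by (metis dvdE)
    have "is_homogeneous p" by (rule is_homogeneous_factor(1)[OF h(2,1)[unfolded c]])
    moreover have "p \<noteq> 0" using c h(1) by auto
    ultimately show ?thesis by (intro initial_degree_multiples)
  qed
  have fin: "finite (initial_degree ` Ass ?I)" and ne: "initial_degree ` Ass ?I \<noteq> {}"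
    using finite_Ass_multiples[OF h(1)] Ass_multiples_nonempty[OF h(1,3)] by auto
  have "?M \<in> initial_degree ` Ass ?I"
    unfolding max_initial_degree_def by (rule Max_in[OF fin ne])
  then obtain P where P: "P \<in> Ass ?I" "?M = initial_degree P" by (metis imageE)
  then obtain p where "P = {f. p dvd f}" "p dvd h"
    unfolding Ass_multiples[OF h(1)] by blast
  hence p: "{f. p dvd f} \<in> Ass ?I" "p dvd h" "?M = total_degree p"
    using P in_deg by auto
  have "v_number ?I = total_degree h - ?M"
    unfolding v_number_def
  proof (rule Least_equality)
    show "\<exists>f\<in>graded_part (int (total_degree h - ?M)). \<exists>P\<in>Ass ?I. colon ?I f = P"
      using colon_witness(1)[OF h(1,2) p(2)] p(1) unfolding p(3) by metis
  next
    fix d assume "\<exists>f\<in>graded_part (int d). \<exists>P\<in>Ass ?I. colon ?I f = P"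
    then obtain f q where f: "f \<in> graded_part (int d)" "colon ?I f = {f. q dvd f}"
      and q: "prime_elem q" "q dvd h" "{f. q dvd f} \<in> Ass ?I"
      unfolding Ass_multiples[OF h(1)] by blast
    have "total_degree q \<le> ?M"
      unfolding max_initial_degree_def using fin q(2,3) in_deg[of q] by (metis Max_ge imageI)
    thus "total_degree h - ?M \<le> d"
      using degree_of_colon_witness[OF h(1) _ q(2) f] q(1) unfolding prime_elem_def by linarith
  qed
  thus ?thesis using colon_witness(2)[OF h(1,2) p(2)] p(3) by simp
qed

section \<open>The minimal free resolution of a principal ideal\<close>

text \<open>
  Minimality of a resolution is a statement about constant terms: the elements of the irrelevant
  ideal have none, and so no matrix entry in positive homological degree has one, whereas the
  nonzero entry of a basis vector is a constant.
\<close>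
definition constant_free :: "('n::finite, 'k::field) mpoly set" where
  "constant_free = {f. component monom_deg 0 f = 0}"

lemma constant_free_0 [simp]: "0 \<in> constant_free"
  by (auto simp: constant_free_def intro: component_eq_0)

lemma constant_free_add: "f \<in> constant_free \<Longrightarrow> g \<in> constant_free \<Longrightarrow> f + g \<in> constant_free"
  by (simp add: constant_free_def component_add)

lemma constant_free_mult:
  assumes "f \<in> constant_free"
  shows "f * g \<in> constant_free" "g * f \<in> constant_free"
proof -
  have "component monom_deg (0 + 0) (f * g) = component monom_deg 0 f * component monom_deg 0 g"
    by (rule component_mult_extremal[OF additive_weight_monom_deg]) simp
  thus "f * g \<in> constant_free" using assms by (simp add: constant_free_def)
  thus "g * f \<in> constant_free" by (simp add: mult.commute)
qed

lemma constant_free_sum: "(\<And>i. i \<in> A \<Longrightarrow> f i \<in> constant_free) \<Longrightarrow> sum f A \<in> constant_free"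
  by (induction A rule: infinite_finite_induct) (auto intro: constant_free_add)

lemma one_not_constant_free: "(1 :: ('n::finite, 'k::field) mpoly) \<notin> constant_free"
proof -
  have "component monom_deg 0 1 = (1 :: ('n, 'k) mpoly)"
    using additive_weight_0[OF additive_weight_monom_deg]
    by (intro component_eq_self) (simp add: homogeneous_def)
  thus ?thesis by (simp add: constant_free_def)
qed

lemma ideal_class_ringI:
  fixes A :: "'a::comm_ring_1 set"
  assumes "0 \<in> A" "\<And>a b. a \<in> A \<Longrightarrow> b \<in> A \<Longrightarrow> a + b \<in> A" "\<And>a b. a \<in> A \<Longrightarrow> b * a \<in> A"
  shows "ideal A class_ring"
proof (rule idealI[OF ring_class_ring])
  show "subgroup A (add_monoid class_ring)"
  proof
    fix x assume x: "x \<in> A"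
    have "a_inv class_ring x = - x"
      by (rule abelian_group.minus_equality[OF ring.axioms(1)[OF ring_class_ring]]) simp_all
    moreover have "- x \<in> A" using assms(3)[OF x, of "-1"] by simp
    ultimately show "inv\<^bsub>add_monoid class_ring\<^esub> x \<in> A" by (simp add: a_inv_def)
  qed (use assms in auto)
  show "a \<otimes>\<^bsub>class_ring\<^esub> x \<in> A" if "a \<in> A" for a x
    using assms(3)[OF that, of x] by (simp add: mult.commute)
qed (use assms in auto)

lemma irrelevant_ideal_subset: "irrelevant_ideal \<subseteq> constant_free"
  unfolding irrelevant_ideal_def
proof (rule ring.genideal_minimal[OF ring_class_ring])
  show "ideal constant_free class_ring"
    by (rule ideal_class_ringI) (auto intro: constant_free_add constant_free_mult)
  show "{Poly_Mapping.single (Poly_Mapping.single i 1) 1 | i. True} \<subseteq> constant_free"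
    by (auto simp: constant_free_def monom_deg_def lookup_single when_def split: if_splits intro!: component_eq_0)
qed

lemma mult_mat_vec_entry:
  fixes A :: "'a::comm_ring_1 mat"
  assumes "A \<in> carrier_mat r c" "w \<in> carrier_vec c" "q < r"
  shows "(A *\<^sub>v w) $ q = (\<Sum>p<c. A $$ (q, p) * w $ p)"
  using assms by (auto simp: scalar_prod_def lessThan_atLeast0)

lemma graded_part_nonzero:
  assumes "f \<noteq> 0" "f \<in> graded_part j"
  shows "is_homogeneous f" "j = int (total_degree f)"
proof -
  obtain m where "m \<in> Poly_Mapping.keys f" using assms(1) by (metis keys_eq_empty ex_in_conv)
  hence "int (monom_deg m) = j" using assms(2) by (auto simp: graded_part_def)
  hence j: "j = int (monom_deg m)" by simp
  have hom: "is_homogeneous f \<and> total_degree f = monom_deg m"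
    using graded_part_iff[OF assms(1)] assms(2) unfolding j by blast
  thus "is_homogeneous f" by (rule conjunct1)
  show "j = int (total_degree f)" using j conjunct2[OF hom] by simp
qed

context
  fixes h :: "('n::finite, 'k::field) mpoly" and a :: "nat \<Rightarrow> int list"
    and \<phi> :: "nat \<Rightarrow> ('n, 'k) mpoly mat"
  assumes h: "h \<noteq> 0" "is_homogeneous h"
    and res: "minimal_graded_free_resolution {f. h dvd f} a \<phi>"
begin

lemma augmentation_carrier: "\<phi> 0 \<in> carrier_mat 1 (length (a 0))"
  using res by (simp add: minimal_graded_free_resolution_def)

lemma differential_carrier: "\<phi> (Suc i) \<in> carrier_mat (length (a i)) (length (a (Suc i)))"
  using res by (simp add: minimal_graded_free_resolution_def)

lemma exactness: "mat_kernel (\<phi> i) = (\<lambda>w. \<phi> (Suc i) *\<^sub>v w) ` carrier_vec (length (a (Suc i)))"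
  using res by (simp add: minimal_graded_free_resolution_def)

lemma augmentation_image:
  "(\<lambda>w. (\<phi> 0 *\<^sub>v w) $ 0) ` carrier_vec (length (a 0)) = {f. h dvd f}"
  using res by (simp add: minimal_graded_free_resolution_def)

lemma kernel_constant_free:
  assumes "v \<in> mat_kernel (\<phi> i)" "q < length (a i)"
  shows "v $ q \<in> constant_free"
proof -
  obtain w where w: "w \<in> carrier_vec (length (a (Suc i)))" "v = \<phi> (Suc i) *\<^sub>v w"
    using assms(1) unfolding exactness by (metis imageE)
  have "\<phi> (Suc i) $$ (q, p) \<in> constant_free" if "p < length (a (Suc i))" for p
  proof -
    have "\<phi> (Suc i) $$ (q, p) \<in> irrelevant_ideal"
      using res assms(2) that by (simp add: minimal_graded_free_resolution_def)
    thus ?thesis using irrelevant_ideal_subset by (rule rev_subsetD)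
  qed
  thus ?thesis
    unfolding w(2) mult_mat_vec_entry[OF differential_carrier w(1) assms(2)]
    by (intro constant_free_sum constant_free_mult(1)) simp
qed

text \<open>
  If the differential vanishes, then its kernel contains every basis vector, and by minimality no
  basis vector is in the image of the next differential.
\<close>
lemma no_generators_if_differential_0:
  assumes "\<And>v. v \<in> carrier_vec (length (a (Suc i))) \<Longrightarrow> \<phi> (Suc i) *\<^sub>v v = 0\<^sub>v (length (a i))"
  shows "a (Suc i) = []"
proof (rule ccontr)
  let ?n = "length (a (Suc i))"
  assume "a (Suc i) \<noteq> []"
  hence n: "0 < ?n" by simp
  have "unit_vec ?n 0 \<in> mat_kernel (\<phi> (Suc i))"
    using assms[of "unit_vec ?n 0"] differential_carrier[of i] by (intro mat_kernelI) auto
  from kernel_constant_free[OF this n] n show False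
    by (simp add: one_not_constant_free)
qed

text \<open>
  The entries of the augmentation are \<open>h u\<^sub>p\<close> with homogeneous \<open>u\<^sub>p\<close>. As \<open>h\<close> is in the image,
  \<open>\<Sum>u\<^sub>p w\<^sub>p = 1\<close> for some \<open>w\<close>, so some \<open>u\<^sub>b\<close> has a constant term; being homogeneous, it is a unit. Any further generator \<open>q\<close>
  would give the relation \<open>e\<^sub>q - u\<^sub>q u\<^sub>b\<^sup>-\<^sup>1 e\<^sub>b\<close> with a constant entry, against minimality.
\<close>
lemma generators_of_principal_ideal: "a 0 = [int (total_degree h)]"
  and augmentation_injective:
    "w \<in> mat_kernel (\<phi> 0) \<Longrightarrow> w = 0\<^sub>v (length (a 0))"
proof -
  let ?r = "length (a 0)"
  have entry: "(\<phi> 0 *\<^sub>v w) $ 0 = (\<Sum>p<?r. \<phi> 0 $$ (0, p) * w $ p)" if "w \<in> carrier_vec ?r" for w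
    by (rule mult_mat_vec_entry[OF augmentation_carrier that]) simp
  have "h dvd \<phi> 0 $$ (0, p)" if p: "p < ?r" for p
  proof -
    have "(\<phi> 0 *\<^sub>v unit_vec ?r p) $ 0 = \<phi> 0 $$ (0, p)"
      using p augmentation_carrier by (subst entry) (auto simp: if_distrib sum.delta cong: if_cong)
    thus ?thesis using augmentation_image by (metis (mono_tags, lifting) imageI mem_Collect_eq unit_vec_carrier)
  qed
  hence "\<forall>p. \<exists>u. p < ?r \<longrightarrow> \<phi> 0 $$ (0, p) = h * u" by (metis dvdE)
  then obtain u where u: "\<And>p. p < ?r \<Longrightarrow> \<phi> 0 $$ (0, p) = h * u p" by metis
  have entry': "(\<phi> 0 *\<^sub>v w) $ 0 = h * (\<Sum>p<?r. u p * w $ p)" if "w \<in> carrier_vec ?r" for w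
    by (simp add: entry[OF that] u sum_distrib_left mult.assoc)
  have kernelI: "w \<in> mat_kernel (\<phi> 0)" if "w \<in> carrier_vec ?r" "(\<Sum>p<?r. u p * w $ p) = 0" for w
  proof (rule mat_kernelI[OF augmentation_carrier that(1)])
    show "\<phi> 0 *\<^sub>v w = 0\<^sub>v 1"
      by (rule eq_vecI) (use entry'[OF that(1)] that(2) augmentation_carrier in auto)
  qed
  obtain z where z: "z \<in> carrier_vec ?r" "(\<phi> 0 *\<^sub>v z) $ 0 = h"
    using augmentation_image by (metis (mono_tags, lifting) dvd_refl imageE mem_Collect_eq)
  have "h * (\<Sum>p<?r. u p * z $ p) = h * 1" using entry'[OF z(1)] z(2) by simp
  hence "(\<Sum>p<?r. u p * z $ p) = 1" by (rule iffD1[OF mpoly_mult_left_cancel[OF h(1)]])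
  hence "(\<Sum>p<?r. u p * z $ p) \<notin> constant_free" using one_not_constant_free by simp
  hence "\<not> (\<forall>p<?r. u p \<in> constant_free)"
    using constant_free_sum[of "{..<?r}" "\<lambda>p. u p * z $ p"] constant_free_mult(1) by blast
  then obtain b where b: "b < ?r" "u b \<notin> constant_free" by blast
  have ub: "u b \<noteq> 0" using b(2) by auto
  have "\<phi> 0 $$ (0, b) \<in> graded_part (a 0 ! b)"
    using res b(1) by (simp add: minimal_graded_free_resolution_def)
  hence grad: "h * u b \<in> graded_part (a 0 ! b)" using u[OF b(1)] by simp
  have hub: "h * u b \<noteq> 0" using h(1) ub by (simp add: mpoly_mult_eq_0_iff)
  have "is_homogeneous (u b)"
    using is_homogeneous_factor(2)[OF graded_part_nonzero(1)[OF hub grad] hub] .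
  moreover have "component monom_deg 0 (u b) \<noteq> 0" using b(2) by (simp add: constant_free_def)
  ultimately have deg: "total_degree (u b) = 0"
    using component_eq_0[of "u b" monom_deg 0] unfolding homogeneous_def by metis
  hence "u b dvd 1" using unit_iff_degree_0[OF ub] by simp
  then obtain v where v: "u b * v = 1" by (metis dvdE)
  have only: "q = b" if q: "q < ?r" for q
  proof (rule ccontr)
    assume "q \<noteq> b"
    \<comment> \<open>The relation \<open>e\<^sub>q - u\<^sub>q v e\<^sub>b\<close>, where \<open>v\<close> is the inverse of \<open>u\<^sub>b\<close>.\<close>
    let ?w = "vec ?r (\<lambda>p. (if p = q then 1 else 0) + (if p = b then - (v * u q) else 0))"
    have "(\<Sum>p<?r. u p * ?w $ p)
        = (\<Sum>p<?r. (if p = q then u p else 0) + (if p = b then u p * - (v * u q) else 0))"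
      by (rule sum.cong) (auto simp: algebra_simps)
    also have "\<dots> = u q - (u b * v) * u q"
      using q b(1) by (simp add: sum.distrib mult.assoc)
    also have "\<dots> = 0" using v by simp
    finally have "?w \<in> mat_kernel (\<phi> 0)" by (intro kernelI) auto
    from kernel_constant_free[OF this q] show False
      using q \<open>q \<noteq> b\<close> by (simp add: one_not_constant_free)
  qed
  have b0: "b = 0" and len: "?r = 1"
  proof -
    have "0 < ?r" using b(1) by linarith
    thus "b = 0" using only by metis
    moreover have "\<not> 1 < ?r" using only[of 1] \<open>b = 0\<close> by linarith
    ultimately show "?r = 1" using b(1) by linarith
  qed
  have "a 0 ! 0 = int (total_degree h)"
    using graded_part_nonzero(2)[OF hub grad] total_degree_mult[OF h(1) ub] deg b0 by simp
  thus "a 0 = [int (total_degree h)]" using len by (cases "a 0") auto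
  show "w = 0\<^sub>v ?r" if w: "w \<in> mat_kernel (\<phi> 0)"
  proof -
    have wc: "w \<in> carrier_vec ?r" "\<phi> 0 *\<^sub>v w = 0\<^sub>v 1"
      using mat_kernelD[OF augmentation_carrier w] by auto
    have "h * (u 0 * w $ 0) = 0"
      using entry'[OF wc(1)] wc(2) len by simp
    hence "w $ 0 = 0" using h(1) ub b0 by (simp add: mpoly_mult_eq_0_iff)
    thus ?thesis using wc(1) len by (intro eq_vecI) auto
  qed
qed

text \<open>
  The augmentation is injective, so the first differential vanishes and \<open>F\<^sub>1 = 0\<close>. From then on every
  differential maps into the zero module.
\<close>
lemma no_higher_syzygies: "a (Suc i) = []"
proof (induction i)
  case 0
  show ?case
  proof (rule no_generators_if_differential_0)
    fix v :: "('n, 'k) mpoly vec" assume "v \<in> carrier_vec (length (a (Suc 0)))"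
    hence "\<phi> (Suc 0) *\<^sub>v v \<in> mat_kernel (\<phi> 0)" unfolding exactness by (rule imageI)
    thus "\<phi> (Suc 0) *\<^sub>v v = 0\<^sub>v (length (a 0))" by (rule augmentation_injective)
  qed
next
  case (Suc i)
  show ?case
  proof (rule no_generators_if_differential_0)
    fix v :: "('n, 'k) mpoly vec" assume "v \<in> carrier_vec (length (a (Suc (Suc i))))"
    show "\<phi> (Suc (Suc i)) *\<^sub>v v = 0\<^sub>v (length (a (Suc i)))"
      using differential_carrier[of "Suc i"] Suc by (intro eq_vecI) auto
  qed
qed

end

text \<open>
  The resolution is \<open>0 \<rightarrow> S(-deg h) \<rightarrow> (h)\<close>. The zero matrices have no columns, and the first of them
  has one row because \<open>F\<^sub>0\<close> has rank one.
\<close>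
lemma minimal_graded_free_resolution_multiples:
  fixes h :: "('n::finite, 'k::field) mpoly"
  assumes h: "h \<noteq> 0" "is_homogeneous h"
  shows "minimal_graded_free_resolution {f. h dvd f}
    (\<lambda>i. if i = 0 then [int (total_degree h)] else [])
    (\<lambda>i. if i = 0 then mat 1 1 (\<lambda>_. h) else 0\<^sub>m (if i = 1 then 1 else 0) 0)"
  (is "minimal_graded_free_resolution _ ?a ?\<phi>")
  unfolding minimal_graded_free_resolution_def
proof (intro conjI allI impI)
  have entry: "(?\<phi> 0 *\<^sub>v w) $ 0 = h * w $ 0" if "w \<in> carrier_vec 1" for w
    using that by (auto simp: scalar_prod_def)
  show "(\<lambda>w. (?\<phi> 0 *\<^sub>v w) $ 0) ` carrier_vec (length (?a 0)) = {f. h dvd f}"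
  proof (intro equalityI subsetI)
    fix f assume "f \<in> {f. h dvd f}"
    then obtain t where t: "f = h * t" by (auto elim: dvdE)
    have "vec 1 (\<lambda>_. t) \<in> carrier_vec (length (?a 0))" by simp
    moreover have "f = (?\<phi> 0 *\<^sub>v vec 1 (\<lambda>_. t)) $ 0"
      by (subst entry) (simp_all add: t)
    ultimately show "f \<in> (\<lambda>w. (?\<phi> 0 *\<^sub>v w) $ 0) ` carrier_vec (length (?a 0))" by (rule rev_image_eqI)
  next
    fix f assume "f \<in> (\<lambda>w. (?\<phi> 0 *\<^sub>v w) $ 0) ` carrier_vec (length (?a 0))"
    then obtain w where "w \<in> carrier_vec 1" "f = (?\<phi> 0 *\<^sub>v w) $ 0" by auto
    thus "f \<in> {f. h dvd f}" using entry by simp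
  qed
  show "?\<phi> 0 $$ (0, p) \<in> graded_part (?a 0 ! p)" if "p < length (?a 0)" for p
    using that h graded_part_iff[OF h(1)] by simp
  fix i
  show "mat_kernel (?\<phi> i) = (\<lambda>w. ?\<phi> (Suc i) *\<^sub>v w) ` carrier_vec (length (?a (Suc i)))"
  proof (cases i)
    case 0
    have c: "?\<phi> 0 \<in> carrier_mat 1 1" by simp
    have "w = 0\<^sub>v 1" if w: "w \<in> mat_kernel (?\<phi> 0)" for w
    proof -
      have wc: "w \<in> carrier_vec 1" "?\<phi> 0 *\<^sub>v w = 0\<^sub>v 1" using mat_kernelD[OF c w] by auto
      have "h * w $ 0 = (?\<phi> 0 *\<^sub>v w) $ 0" by (rule entry[OF wc(1), symmetric])
      also have "\<dots> = 0" unfolding wc(2) by simp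
      finally have "h * w $ 0 = 0" .
      hence "w $ 0 = 0" using h(1) by (simp add: mpoly_mult_eq_0_iff)
      thus ?thesis using wc(1) by (intro eq_vecI) auto
    qed
    moreover have "0\<^sub>v 1 \<in> mat_kernel (?\<phi> 0)"
      by (rule mat_kernelI[OF c]) (auto intro!: eq_vecI simp: scalar_prod_def)
    ultimately have "mat_kernel (?\<phi> 0) = {0\<^sub>v 1}" by blast
    moreover have "?\<phi> 1 *\<^sub>v w = 0\<^sub>v 1" if "w \<in> carrier_vec 0" for w
      by (intro eq_vecI) (use that in \<open>auto simp: scalar_prod_def\<close>)
    ultimately show ?thesis using 0 by (auto simp: image_iff intro!: exI[of _ "0\<^sub>v 0"])
  next
    case (Suc j)
    have "mat_kernel (?\<phi> (Suc j)) = {0\<^sub>v 0}"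
      unfolding mat_kernel_def by (auto intro!: eq_vecI simp: scalar_prod_def)
    moreover have "?\<phi> (Suc (Suc j)) *\<^sub>v w = 0\<^sub>v 0" for w
      by (intro eq_vecI) auto
    ultimately show ?thesis using Suc by (auto simp: image_iff intro!: exI[of _ "0\<^sub>v 0"])
  qed
qed auto

text \<open>
  The definite description in \<open>graded_betti\<close> needs both the existence of a minimal resolution and the
  fact that all of them have the same generators.
\<close>
lemma graded_betti_multiples:
  fixes h :: "('n::finite, 'k::field) mpoly"
  assumes h: "h \<noteq> 0" "is_homogeneous h"
  shows "graded_betti {f. h dvd f} i j = (if i = 0 \<and> j = int (total_degree h) then 1 else 0)"
  unfolding graded_betti_def
proof (rule the_equality)
  show "\<exists>a \<phi>. minimal_graded_free_resolution {f. h dvd f} a \<phi> \<and>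
      (if i = 0 \<and> j = int (total_degree h) then 1 else 0) = count_list (a i) j"
    by (intro exI conjI, rule minimal_graded_free_resolution_multiples[OF h]) simp
next
  fix b assume "\<exists>a \<phi>. minimal_graded_free_resolution {f. h dvd f} a \<phi> \<and> b = count_list (a i) j"
  then obtain a \<phi> where res: "minimal_graded_free_resolution {f. h dvd f} a \<phi>" and b: "b = count_list (a i) j"
    by blast
  show "b = (if i = 0 \<and> j = int (total_degree h) then 1 else 0)"
    using generators_of_principal_ideal[OF h res] no_higher_syzygies[OF h res] b by (cases i) auto
qed

lemma linear_resolution_multiples:
  fixes h :: "('n::finite, 'k::field) mpoly"
  assumes h: "h \<noteq> 0" "is_homogeneous h"
  shows "linear_resolution {f. h dvd f}"
  unfolding linear_resolution_def
proof
  let ?I = "{f. h dvd f}" and ?d = "int (total_degree h)"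
  have gen: "?I = genideal class_ring (?I \<inter> graded_part ?d)"
  proof (rule equalityI)
    have "h \<in> genideal class_ring (?I \<inter> graded_part ?d)"
      using ring.genideal_self[OF ring_class_ring, of "?I \<inter> graded_part ?d"] h(2) graded_part_iff[OF h(1)]
      by fastforce
    hence "genideal class_ring {h} \<subseteq> genideal class_ring (?I \<inter> graded_part ?d)"
      by (intro ring.genideal_minimal[OF ring_class_ring] ring.genideal_ideal[OF ring_class_ring]) auto
    thus "?I \<subseteq> genideal class_ring (?I \<inter> graded_part ?d)" by (simp add: genideal_singleton)
    show "genideal class_ring (?I \<inter> graded_part ?d) \<subseteq> ?I"
      by (rule ring.genideal_minimal[OF ring_class_ring ideal_multiples]) auto
  qed
  show "equigenerated ?I"
    unfolding equigenerated_def by (intro conjI exI, rule ideal_multiples, rule gen)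
  have "{j - int i | i j. graded_betti ?I i j \<noteq> 0} = {?d}"
    unfolding graded_betti_multiples[OF h] by auto
  thus "regularity ?I = int (initial_degree ?I)"
    unfolding regularity_def initial_degree_multiples[OF h] by simp
qed

section \<open>Powers of a graded principal ideal\<close>

text \<open>
  A nonzero graded ideal contains a nonzero homogeneous element; it is a multiple of the generator
  \<open>g\<close>, and factors of homogeneous polynomials are homogeneous.
\<close>
lemma graded_principal_ideal_homogeneous_generator:
  fixes I :: "('n::finite, 'k::field) mpoly set"
  assumes "graded_ideal I" "principalideal I class_ring" "I \<noteq> {0}"
  obtains g where "I = {f. g dvd f}" "g \<noteq> 0" "is_homogeneous g"
proof -
  obtain g where "I = genideal class_ring {g}"
    using principalideal.generate[OF assms(2)] by blast
  hence g: "I = {f. g dvd f}" by (simp add: genideal_singleton)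
  have "\<exists>h\<in>I. h \<noteq> 0 \<and> (\<exists>d. h \<in> graded_part d)"
  proof (rule ccontr)
    assume "\<not> ?thesis"
    hence "I \<inter> (\<Union>d. graded_part d) \<subseteq> {f. 0 dvd f}" by auto
    hence "genideal class_ring (I \<inter> (\<Union>d. graded_part d)) \<subseteq> {f. 0 dvd f}"
      by (rule ring.genideal_minimal[OF ring_class_ring ideal_multiples])
    hence "I \<subseteq> {0}" using assms(1) by (auto simp: graded_ideal_def)
    thus False using assms(3) g by auto
  qed
  then obtain h d where h: "h \<in> I" "h \<noteq> 0" "h \<in> graded_part d" by auto
  have "d \<ge> 0"
  proof -
    obtain m where "m \<in> Poly_Mapping.keys h" using h(2) by (metis keys_eq_empty ex_in_conv)
    hence "int (monom_deg m) = d" using h(3) by (auto simp: graded_part_def)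
    thus ?thesis by auto
  qed
  hence "h \<in> graded_part (int (nat d))" using h(3) by simp
  hence "is_homogeneous h" using graded_part_iff[OF h(2)] by blast
  moreover obtain q where q: "h = g * q" using h(1) g by (auto elim: dvdE)
  ultimately have "is_homogeneous g" using is_homogeneous_factor(1)[of g q] h(2) by simp
  moreover have "g \<noteq> 0" using q h(2) by auto
  ultimately show ?thesis using that[OF g] by blast
qed

theorem theorem3p6:
  fixes I :: "('n::finite, 'k::field) mpoly set"
  assumes "graded_ideal I"
    and "principalideal I class_ring"
    and "I \<noteq> {0}"
    and "I \<noteq> UNIV"
  shows "linear_powers I \<and>
    (\<forall>k\<ge>1. \<forall>P\<in>Ass (ideal_power I k).
       int (local_v_number P (ideal_power I k))
         = int (initial_degree I) * int k - int (initial_degree P)) \<and>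
    (\<forall>k\<ge>1. int (v_number (ideal_power I k))
         = int (initial_degree I) * int k - int (max_initial_degree I))"
proof -
  obtain g where g: "I = {f. g dvd f}" "g \<noteq> 0" "is_homogeneous g"
    using graded_principal_ideal_homogeneous_generator[OF assms(1-3)] by metis
  have nonunit: "\<not> g dvd 1"
  proof
    assume "g dvd 1"
    hence "g dvd f" for f by (rule dvd_trans) simp
    thus False using assms(4) g(1) by auto
  qed
  have pow: "ideal_power I k = {f. g ^ k dvd f}" for k
    unfolding g(1) by (rule ideal_power_multiples)
  note power = mpoly_power_nonzero[OF g(2)] is_homogeneous_power[OF g(3)]
  have deg: "total_degree (g ^ k) = initial_degree I * k" for k
    by (simp add: total_degree_power[OF g(2)] initial_degree_multiples[OF g(2,3)] g(1))
  have "linear_powers I"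
    by (simp add: linear_powers_def pow linear_resolution_multiples[OF power])
  moreover have "int (local_v_number P (ideal_power I k))
      = int (initial_degree I) * int k - int (initial_degree P)"
    if P: "P \<in> Ass (ideal_power I k)" for k P
  proof -
    obtain p where p: "P = {f. p dvd f}" "prime_elem p" "p dvd g ^ k"
      using P unfolding pow Ass_multiples[OF power(1)] by blast
    obtain c where c: "g ^ k = p * c" using p(3) by (metis dvdE)
    have "is_homogeneous p"
      by (rule is_homogeneous_factor(1)[OF power(2,1)[of k, unfolded c]])
    hence "initial_degree P = total_degree p"
      using p(2) unfolding p(1) by (intro initial_degree_multiples) auto
    moreover have "local_v_number P (ideal_power I k) = total_degree (g ^ k) - total_degree p"
      using p(2,3) unfolding pow p(1) prime_elem_def by (intro local_v_number_multiples power) blast+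
    moreover have "total_degree p \<le> total_degree (g ^ k)" by (rule colon_witness(2)[OF power p(3)])
    ultimately show ?thesis using deg[of k] by (simp flip: of_nat_mult)
  qed
  moreover have "int (v_number (ideal_power I k))
      = int (initial_degree I) * int k - int (max_initial_degree I)" if k: "k \<ge> 1" for k
  proof -
    have "g dvd g ^ k" using k by (intro dvd_power) simp
    hence "\<not> g ^ k dvd 1" using nonunit dvd_trans by blast
    hence "v_number (ideal_power I k) + max_initial_degree (ideal_power I k) = total_degree (g ^ k)"
      unfolding pow by (rule v_number_multiples[OF power])
    moreover have "max_initial_degree (ideal_power I k) = max_initial_degree I"
      unfolding max_initial_degree_def pow Ass_multiples_power[OF g(2) k] by (simp only: g(1))
    ultimately show ?thesis using deg[of k] by (simp flip: of_nat_mult)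
  qed
  ultimately show ?thesis by blast
qed

end
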